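(* Let $p$ be a prime, $\alpha>1$, and let $0<M_0<M_1<M_2<\cdots$ be real numbers with $M_n\to\infty$. Let $f:\mathbb{Q}_p\to\mathbb{C}$ be locally integrable and suppose that $f$ has the asymptotic expansion $$f(x)\sim\sum_{n=0}^\infty a_n|x|_p^{M_n},\qquad |x|_p\to 0,\quad a_n\in\mathbb{C},$$ i.e. for every $N\ge 0$, $f(x)-\sum_{n=0}^N a_n|x|_p^{M_n}=o(|x|_p^{M_N})$ as $|x|_p\to 0$. Then $$(I^\alpha f)(x)\sim \frac{1-p^{-\alpha}}{1-p^{\alpha-1}}\sum_{n=0}^\infty a_n b_n|x|_p^{M_n+\alpha},\qquad |x|_p\to 0,$$ i.e. for every $N\ge0$, $(I^\alpha f)(x)-\frac{1-p^{-\alpha}}{1-p^{\alpha-1}}\sum_{n=0}^N a_nb_n|x|_p^{M_n+\alpha}=o(|x|_p^{M_N+\alpha})$ as $|x|_p\to0$, where $$b_n=\frac{p^{-\alpha+1}-1}{(1-p^{-\alpha})p}+(1-p^{-1})\sum_{k=1}^\infty\bigl(1-p^{-k(\alpha-1)}\bigr)p^{-k(M_n+1)}.$$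
   Context: $\mathbb{Q}_p$ is the field of $p$-adic numbers with the $p$-adic absolute value $|\cdot|_p$; $dx$ is the Haar measure on $\mathbb{Q}_p$ normalized so that $\int_{|x|_p\le1}dx=1$. For $\alpha>1$ and a locally integrable $f:\mathbb{Q}_p\to\mathbb{C}$, the $p$-adic fractional integration operator is $$(I^\alpha f)(x)=\frac{1-p^{-\alpha}}{1-p^{\alpha-1}}\int_{|y|_p\le|x|_p}\bigl(|x-y|_p^{\alpha-1}-|y|_p^{\alpha-1}\bigr)f(y)\,dy.$$ *)

theory Defs
  imports
    "HOL-Analysis.Analysis"
    "HOL-Computational_Algebra.Primes"
    "HOL-Library.Landau_Symbols"
begin

section \<open>The \<open>p\<close>-adic absolute value on the rationals\<close>

definition rat_padic_abs :: "nat \<Rightarrow> rat \<Rightarrow> real" where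
  "rat_padic_abs p q =
    (if q = 0 then 0
     else real p powi (int (multiplicity (int p) (snd (quotient_of q)))
                     - int (multiplicity (int p) (fst (quotient_of q)))))"

lemma rat_padic_abs_0 [simp]: "rat_padic_abs p 0 = 0"
  by (simp add: rat_padic_abs_def)

lemma rat_padic_abs_frac:
  assumes p: "prime p" and a: "a \<noteq> 0" and b: "b \<noteq> 0"
  shows "rat_padic_abs p (of_int a / of_int b) =
    real p powi (int (multiplicity (int p) b) - int (multiplicity (int p) a))"
proof -
  let ?q = "of_int a / of_int b :: rat"
  obtain c d where cd: "quotient_of ?q = (c, d)" by fastforce
  have d: "d > 0" using quotient_of_denom_pos[OF cd] .
  have q: "?q = of_int c / of_int d" using quotient_of_div[OF cd] .
  have nz: "?q \<noteq> 0" using a b by simp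
  then have c: "c \<noteq> 0" using q by auto
  have "(of_int (a * d) :: rat) = of_int (c * b)"
    using q b d by (simp add: field_simps)
  then have eq: "a * d = c * b" by (simp only: of_int_eq_iff)
  have pp: "prime_elem (int p)" using p by simp
  have "multiplicity (int p) a + multiplicity (int p) d
      = multiplicity (int p) c + multiplicity (int p) b"
    using arg_cong[OF eq, of "multiplicity (int p)"] pp a b c d
    by (simp add: prime_elem_multiplicity_mult_distrib)
  then have "int (multiplicity (int p) d) - int (multiplicity (int p) c)
           = int (multiplicity (int p) b) - int (multiplicity (int p) a)" by linarith
  then show ?thesis using nz cd by (simp add: rat_padic_abs_def)
qed

lemma rat_frac_cases:
  fixes x :: rat
  assumes "x \<noteq> 0"
  obtains a b where "x = of_int a / of_int b" "a \<noteq> 0" "b \<noteq> 0"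
proof -
  obtain c d where cd: "quotient_of x = (c, d)" by fastforce
  have d: "d > 0" using quotient_of_denom_pos[OF cd] .
  have q: "x = of_int c / of_int d" using quotient_of_div[OF cd] .
  then have "c \<noteq> 0" using assms by auto
  then show ?thesis using that q d by blast
qed

lemma rat_padic_abs_mult:
  assumes p: "prime p"
  shows "rat_padic_abs p (x * y) = rat_padic_abs p x * rat_padic_abs p y"
proof (cases "x = 0 \<or> y = 0")
  case False
  then obtain a b c d where ab: "x = of_int a / of_int b" "a \<noteq> 0" "b \<noteq> 0"
    and cd: "y = of_int c / of_int d" "c \<noteq> 0" "d \<noteq> 0"
    by (meson rat_frac_cases)
  have xy: "x * y = of_int (a * c) / of_int (b * d)" using ab cd by simp
  have pp: "prime_elem (int p)" using p by simp
  have p0: "real p \<noteq> 0" using p by (simp add: prime_gt_0_nat)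
  have "rat_padic_abs p (x * y) = real p powi
      (int (multiplicity (int p) (b * d)) - int (multiplicity (int p) (a * c)))"
    unfolding xy by (rule rat_padic_abs_frac[OF p]) (use ab cd in auto)
  also have "\<dots> = real p powi
      ((int (multiplicity (int p) b) - int (multiplicity (int p) a)) +
       (int (multiplicity (int p) d) - int (multiplicity (int p) c)))"
    using pp ab cd by (simp add: prime_elem_multiplicity_mult_distrib algebra_simps)
  also have "\<dots> = rat_padic_abs p x * rat_padic_abs p y"
    using p0 ab cd by (simp add: rat_padic_abs_frac[OF p] power_int_add)
  finally show ?thesis .
qed auto

lemma rat_padic_abs_nonneg [simp]: "rat_padic_abs p x \<ge> 0"
  by (simp add: rat_padic_abs_def)

lemma rat_padic_abs_eq_0_iff: "prime p \<Longrightarrow> rat_padic_abs p x = 0 \<longleftrightarrow> x = 0"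
  by (simp add: rat_padic_abs_def prime_gt_0_nat)

lemma rat_padic_abs_1: "rat_padic_abs p 1 = 1"
  by (simp add: rat_padic_abs_def)

lemma rat_padic_abs_minus: "rat_padic_abs p (- x) = rat_padic_abs p x"
proof -
  have "multiplicity (int p) (- a) = multiplicity (int p) a" for a
    using multiplicity_times_unit_right[of "-1" "int p" a] by simp
  then show ?thesis
    by (simp add: rat_padic_abs_def rat_uminus_code split: prod.splits)
qed

lemma rat_padic_abs_minus_commute: "rat_padic_abs p (x - y) = rat_padic_abs p (y - x)"
  using rat_padic_abs_minus[of p "x - y"] by simp

lemma rat_padic_abs_inverse:
  assumes p: "prime p"
  shows "rat_padic_abs p (inverse x) = inverse (rat_padic_abs p x)"
proof (cases "x = 0")
  case False
  then have "rat_padic_abs p x * rat_padic_abs p (inverse x) = 1"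
    by (simp flip: rat_padic_abs_mult[OF p] add: rat_padic_abs_1)
  then show ?thesis
    by (metis inverse_unique)
qed auto

lemma rat_padic_abs_ultrametric:
  assumes p: "prime p"
  shows "rat_padic_abs p (x + y) \<le> max (rat_padic_abs p x) (rat_padic_abs p y)"
proof (cases "x = 0 \<or> y = 0 \<or> x + y = 0")
  case True
  then show ?thesis by (auto simp: le_max_iff_disj)
next
  case False
  then obtain a b c d where ab: "x = of_int a / of_int b" "a \<noteq> 0" "b \<noteq> 0"
    and cd: "y = of_int c / of_int d" "c \<noteq> 0" "d \<noteq> 0"
    by (meson rat_frac_cases)
  let ?v = "multiplicity (int p)"
  have x: "x = of_int (a * d) / of_int (b * d)" and y: "y = of_int (c * b) / of_int (b * d)"
    using ab cd by (simp_all add: field_simps)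
  have xy: "x + y = of_int (a * d + c * b) / of_int (b * d)"
    using x y by (simp add: add_divide_distrib)
  have nz: "a * d + c * b \<noteq> 0"
    using False xy by (metis div_0 of_int_0)
  have p1: "real p \<ge> 1" using p prime_gt_0_nat[of p] by simp
  have "int p ^ min (?v (a * d)) (?v (c * b)) dvd a * d + c * b"
    by (intro dvd_add multiplicity_dvd') auto
  then have le: "min (?v (a * d)) (?v (c * b)) \<le> ?v (a * d + c * b)"
    using nz p by (intro multiplicity_geI) auto
  have X: "rat_padic_abs p x = real p powi (int (?v (b * d)) - int (?v (a * d)))"
    unfolding x by (rule rat_padic_abs_frac[OF p]) (use ab cd in auto)
  have Y: "rat_padic_abs p y = real p powi (int (?v (b * d)) - int (?v (c * b)))"
    unfolding y by (rule rat_padic_abs_frac[OF p]) (use ab cd in auto)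
  have XY: "rat_padic_abs p (x + y) = real p powi (int (?v (b * d)) - int (?v (a * d + c * b)))"
    unfolding xy by (rule rat_padic_abs_frac[OF p]) (use ab cd nz in auto)
  show ?thesis
  proof (cases "?v (a * d) \<le> ?v (c * b)")
    case True
    then have "rat_padic_abs p (x + y) \<le> rat_padic_abs p x"
      unfolding X XY using le by (intro power_int_increasing p1) auto
    then show ?thesis by simp
  next
    case False
    then have "rat_padic_abs p (x + y) \<le> rat_padic_abs p y"
      unfolding Y XY using le by (intro power_int_increasing p1) auto
    then show ?thesis by simp
  qed
qed

lemma rat_padic_abs_triangle:
  assumes p: "prime p"
  shows "rat_padic_abs p (x + y) \<le> rat_padic_abs p x + rat_padic_abs p y"
  using rat_padic_abs_ultrametric[OF p, of x y] rat_padic_abs_nonneg[of p x]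
    rat_padic_abs_nonneg[of p y] by linarith

lemma rat_padic_abs_diff_le:
  assumes p: "prime p"
  shows "\<bar>rat_padic_abs p x - rat_padic_abs p y\<bar> \<le> rat_padic_abs p (x - y)"
  using rat_padic_abs_triangle[OF p, of "x - y" y] rat_padic_abs_triangle[OF p, of "y - x" x]
    rat_padic_abs_minus_commute[of p x y] by simp


section \<open>\<open>p\<close>-adic Cauchy and null sequences of rationals\<close>

definition padic_vanishes :: "nat \<Rightarrow> (nat \<Rightarrow> rat) \<Rightarrow> bool" where
  "padic_vanishes p X \<longleftrightarrow> (\<lambda>n. rat_padic_abs p (X n)) \<longlonglongrightarrow> 0"

definition padic_cauchy :: "nat \<Rightarrow> (nat \<Rightarrow> rat) \<Rightarrow> bool" where
  "padic_cauchy p X \<longleftrightarrow>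
    (\<forall>e>0. \<exists>k. \<forall>m\<ge>k. \<forall>n\<ge>k. rat_padic_abs p (X m - X n) < e)"

lemma padic_vanishes_0 [simp]: "padic_vanishes p (\<lambda>n. 0)"
  by (simp add: padic_vanishes_def)

lemma padic_vanishes_minus: "padic_vanishes p X \<Longrightarrow> padic_vanishes p (\<lambda>n. - X n)"
  by (simp add: padic_vanishes_def rat_padic_abs_minus)

lemma padic_vanishes_le:
  assumes "\<And>n. rat_padic_abs p (X n) \<le> g n" "g \<longlonglongrightarrow> 0"
  shows "padic_vanishes p X"
  unfolding padic_vanishes_def
  by (rule tendsto_sandwich[OF _ _ tendsto_const assms(2)]) (use assms(1) in auto)

lemma padic_vanishes_add:
  assumes p: "prime p" and "padic_vanishes p X" "padic_vanishes p Y"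
  shows "padic_vanishes p (\<lambda>n. X n + Y n)"
  by (rule padic_vanishes_le[OF rat_padic_abs_triangle[OF p]])
     (use tendsto_add[OF assms(2,3)[unfolded padic_vanishes_def]] in simp)

lemma padic_vanishes_mult:
  assumes p: "prime p" and X: "\<And>n. rat_padic_abs p (X n) \<le> b" and Y: "padic_vanishes p Y"
  shows "padic_vanishes p (\<lambda>n. X n * Y n)"
proof (rule padic_vanishes_le)
  show "rat_padic_abs p (X n * Y n) \<le> b * rat_padic_abs p (Y n)" for n
    unfolding rat_padic_abs_mult[OF p] by (intro mult_right_mono X) auto
  show "(\<lambda>n. b * rat_padic_abs p (Y n)) \<longlonglongrightarrow> 0"
    using tendsto_mult_left[OF Y[unfolded padic_vanishes_def], of b] by simp
qed

lemma padic_cauchy_const [simp]: "padic_cauchy p (\<lambda>n. c)"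
  by (simp add: padic_cauchy_def)

lemma padic_cauchy_minus:
  assumes "padic_cauchy p X"
  shows "padic_cauchy p (\<lambda>n. - X n)"
proof -
  have "rat_padic_abs p (- X m - - X n) = rat_padic_abs p (X m - X n)" for m n
    using rat_padic_abs_minus[of p "X m - X n"] by simp
  then show ?thesis using assms unfolding padic_cauchy_def by presburger
qed

lemma padic_cauchy_add:
  assumes p: "prime p" and X: "padic_cauchy p X" and Y: "padic_cauchy p Y"
  shows "padic_cauchy p (\<lambda>n. X n + Y n)"
  unfolding padic_cauchy_def
proof (intro allI impI)
  fix e :: real assume e: "e > 0"
  obtain i where i: "\<forall>m\<ge>i. \<forall>n\<ge>i. rat_padic_abs p (X m - X n) < e"
    using X e unfolding padic_cauchy_def by blast
  obtain j where j: "\<forall>m\<ge>j. \<forall>n\<ge>j. rat_padic_abs p (Y m - Y n) < e"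
    using Y e unfolding padic_cauchy_def by blast
  have "rat_padic_abs p (X m + Y m - (X n + Y n)) < e" if "m \<ge> max i j" "n \<ge> max i j" for m n
  proof -
    have "X m + Y m - (X n + Y n) = (X m - X n) + (Y m - Y n)" by simp
    then have "rat_padic_abs p (X m + Y m - (X n + Y n))
        \<le> max (rat_padic_abs p (X m - X n)) (rat_padic_abs p (Y m - Y n))"
      by (simp only: rat_padic_abs_ultrametric[OF p])
    also have "\<dots> < e" using i j that by simp
    finally show ?thesis .
  qed
  then show "\<exists>k. \<forall>m\<ge>k. \<forall>n\<ge>k. rat_padic_abs p (X m + Y m - (X n + Y n)) < e" by blast
qed

lemma padic_cauchy_bounded:
  assumes p: "prime p" and X: "padic_cauchy p X"
  obtains b where "b > 0" "\<And>n. rat_padic_abs p (X n) \<le> b"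
proof -
  obtain k where k: "\<forall>m\<ge>k. \<forall>n\<ge>k. rat_padic_abs p (X m - X n) < 1"
    using X zero_less_one unfolding padic_cauchy_def by blast
  define b where "b = (\<Sum>n\<le>k. rat_padic_abs p (X n)) + 1"
  have s: "rat_padic_abs p (X n) \<le> (\<Sum>n\<le>k. rat_padic_abs p (X n))" if "n \<le> k" for n
    using that by (intro member_le_sum) auto
  have "rat_padic_abs p (X n) \<le> b" for n
  proof (cases "n \<le> k")
    case True
    then show ?thesis using s[of n] by (simp add: b_def)
  next
    case False
    then have "rat_padic_abs p (X n - X k) < 1" using k by simp
    then show ?thesis
      using rat_padic_abs_triangle[OF p, of "X n - X k" "X k"] s[of k] by (simp add: b_def)
  qed
  moreover have "b > 0" unfolding b_def by (intro add_nonneg_pos sum_nonneg) auto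
  ultimately show ?thesis using that by blast
qed

lemma padic_cauchy_mult:
  assumes p: "prime p" and X: "padic_cauchy p X" and Y: "padic_cauchy p Y"
  shows "padic_cauchy p (\<lambda>n. X n * Y n)"
  unfolding padic_cauchy_def
proof (intro allI impI)
  fix e :: real assume e: "e > 0"
  obtain a where a: "a > 0" "\<And>n. rat_padic_abs p (X n) \<le> a"
    using padic_cauchy_bounded[OF p X] by blast
  obtain b where b: "b > 0" "\<And>n. rat_padic_abs p (Y n) \<le> b"
    using padic_cauchy_bounded[OF p Y] by blast
  obtain i where i: "\<forall>m\<ge>i. \<forall>n\<ge>i. rat_padic_abs p (X m - X n) < e / b"
    using X e b unfolding padic_cauchy_def by (meson divide_pos_pos)
  obtain j where j: "\<forall>m\<ge>j. \<forall>n\<ge>j. rat_padic_abs p (Y m - Y n) < e / a"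
    using Y e a unfolding padic_cauchy_def by (meson divide_pos_pos)
  have "rat_padic_abs p (X m * Y m - X n * Y n) < e" if "m \<ge> max i j" "n \<ge> max i j" for m n
  proof -
    have "X m * Y m - X n * Y n = X m * (Y m - Y n) + (X m - X n) * Y n"
      by (simp add: algebra_simps)
    then have "rat_padic_abs p (X m * Y m - X n * Y n)
        \<le> max (rat_padic_abs p (X m) * rat_padic_abs p (Y m - Y n))
               (rat_padic_abs p (X m - X n) * rat_padic_abs p (Y n))"
      using rat_padic_abs_ultrametric[OF p] by (simp flip: rat_padic_abs_mult[OF p])
    also have "\<dots> < e"
    proof -
      have "rat_padic_abs p (X m) * rat_padic_abs p (Y m - Y n)
          \<le> a * rat_padic_abs p (Y m - Y n)"
        using a by (intro mult_right_mono) auto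
      also have "\<dots> < e" using j that a by (simp add: field_simps)
      finally have 1: "rat_padic_abs p (X m) * rat_padic_abs p (Y m - Y n) < e" .
      have "rat_padic_abs p (X m - X n) * rat_padic_abs p (Y n)
          \<le> rat_padic_abs p (X m - X n) * b"
        using b by (intro mult_left_mono) auto
      also have "\<dots> < e" using i that b by (simp add: field_simps)
      finally show ?thesis using 1 by simp
    qed
    finally show ?thesis .
  qed
  then show "\<exists>k. \<forall>m\<ge>k. \<forall>n\<ge>k. rat_padic_abs p (X m * Y m - X n * Y n) < e" by blast
qed

lemma padic_cauchy_abs_convergent:
  assumes p: "prime p" and X: "padic_cauchy p X"
  shows "convergent (\<lambda>n. rat_padic_abs p (X n))"
proof (rule real_Cauchy_convergent, rule metric_CauchyI)
  fix e :: real assume "e > 0"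
  then obtain k where k: "\<forall>m\<ge>k. \<forall>n\<ge>k. rat_padic_abs p (X m - X n) < e"
    using X unfolding padic_cauchy_def by blast
  then show "\<exists>k. \<forall>m\<ge>k. \<forall>n\<ge>k. dist (rat_padic_abs p (X m)) (rat_padic_abs p (X n)) < e"
    unfolding dist_real_def using rat_padic_abs_diff_le[OF p] by (meson le_less_trans)
qed

lemma padic_cauchy_not_vanishes:
  assumes p: "prime p" and X: "padic_cauchy p X" and nv: "\<not> padic_vanishes p X"
  obtains b k where "b > 0" "\<And>n. n \<ge> k \<Longrightarrow> rat_padic_abs p (X n) > b"
proof -
  obtain l where l: "(\<lambda>n. rat_padic_abs p (X n)) \<longlonglongrightarrow> l"
    using padic_cauchy_abs_convergent[OF p X] by (auto simp: convergent_def)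
  have "l \<ge> 0" by (rule LIMSEQ_le_const[OF l]) auto
  moreover have "l \<noteq> 0" using l nv by (auto simp: padic_vanishes_def)
  ultimately have "l / 2 < l" "l / 2 > 0" by auto
  with order_tendstoD(1)[OF l, of "l / 2"] that[of "l / 2"] show ?thesis
    by (auto simp: eventually_sequentially)
qed

lemma padic_cauchy_inverse:
  assumes p: "prime p" and X: "padic_cauchy p X" and nv: "\<not> padic_vanishes p X"
  shows "padic_cauchy p (\<lambda>n. inverse (X n))"
  unfolding padic_cauchy_def
proof (intro allI impI)
  fix e :: real assume e: "e > 0"
  obtain b k where b: "b > 0" "\<And>n. n \<ge> k \<Longrightarrow> rat_padic_abs p (X n) > b"
    using padic_cauchy_not_vanishes[OF p X nv] by blast
  obtain i where i: "\<forall>m\<ge>i. \<forall>n\<ge>i. rat_padic_abs p (X m - X n) < e * (b * b)"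
    using X e b unfolding padic_cauchy_def by (meson mult_pos_pos)
  have "rat_padic_abs p (inverse (X m) - inverse (X n)) < e"
    if "m \<ge> max i k" "n \<ge> max i k" for m n
  proof -
    let ?x = "rat_padic_abs p (X m)" and ?y = "rat_padic_abs p (X n)"
    have gt: "?x > b" "?y > b" using b that by auto
    then have nz: "X m \<noteq> 0" "X n \<noteq> 0" using b by auto
    have "rat_padic_abs p (inverse (X m) - inverse (X n)) * (?x * ?y) = rat_padic_abs p (X n - X m)"
    proof -
      have "(inverse (X m) - inverse (X n)) * (X m * X n)
          = (inverse (X m) * X m) * X n - (inverse (X n) * X n) * X m"
        by (simp only: left_diff_distrib mult.assoc) (simp only: mult.commute)
      then have "(inverse (X m) - inverse (X n)) * (X m * X n) = X n - X m"
        using nz by simp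
      then show ?thesis by (metis rat_padic_abs_mult[OF p])
    qed
    also have "\<dots> < e * (b * b)" using i that by simp
    also have "\<dots> \<le> e * (?x * ?y)" using gt b e by (intro mult_left_mono mult_mono) auto
    finally show ?thesis using gt b by simp
  qed
  then show "\<exists>k. \<forall>m\<ge>k. \<forall>n\<ge>k. rat_padic_abs p (inverse (X m) - inverse (X n)) < e" by blast
qed

lemma padic_vanishes_diff_inverse:
  assumes p: "prime p" and X: "padic_cauchy p X" "\<not> padic_vanishes p X"
    and Y: "padic_cauchy p Y" "\<not> padic_vanishes p Y"
    and XY: "padic_vanishes p (\<lambda>n. X n - Y n)"
  shows "padic_vanishes p (\<lambda>n. inverse (X n) - inverse (Y n))"
proof -
  obtain b k where b: "b > 0" "\<And>n. n \<ge> k \<Longrightarrow> rat_padic_abs p (X n) > b"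
    using padic_cauchy_not_vanishes[OF p X] by blast
  obtain c j where c: "c > 0" "\<And>n. n \<ge> j \<Longrightarrow> rat_padic_abs p (Y n) > c"
    using padic_cauchy_not_vanishes[OF p Y] by blast
  have le: "rat_padic_abs p (inverse (X n) - inverse (Y n)) \<le> rat_padic_abs p (X n - Y n) / (b * c)"
    if "n \<ge> max k j" for n
  proof -
    let ?x = "rat_padic_abs p (X n)" and ?y = "rat_padic_abs p (Y n)"
    have gt: "?x > b" "?y > c" using b c that by auto
    then have nz: "X n \<noteq> 0" "Y n \<noteq> 0" using b c by auto
    have "rat_padic_abs p (inverse (X n) - inverse (Y n)) * (b * c)
        \<le> rat_padic_abs p (inverse (X n) - inverse (Y n)) * (?x * ?y)"
      using gt b c by (intro mult_left_mono mult_mono) auto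
    also have "\<dots> = rat_padic_abs p (Y n - X n)"
    proof -
      have "(inverse (X n) - inverse (Y n)) * (X n * Y n)
          = (inverse (X n) * X n) * Y n - (inverse (Y n) * Y n) * X n"
        by (simp only: left_diff_distrib mult.assoc) (simp only: mult.commute)
      then have "(inverse (X n) - inverse (Y n)) * (X n * Y n) = Y n - X n"
        using nz by simp
      then show ?thesis by (metis rat_padic_abs_mult[OF p])
    qed
    finally show ?thesis
      using b c by (simp add: pos_le_divide_eq rat_padic_abs_minus_commute)
  qed
  have "(\<lambda>n. rat_padic_abs p (X n - Y n) / (b * c)) \<longlonglongrightarrow> 0"
    using tendsto_divide[OF XY[unfolded padic_vanishes_def] tendsto_const[of "b * c"]] b c by simp
  then show ?thesis
    unfolding padic_vanishes_def
    by (rule Lim_null_comparison[rotated])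
       (use le in \<open>auto intro!: eventually_sequentiallyI[of "max k j"]\<close>)
qed


section \<open>The field \<open>\<rat>\<^sub>p\<close>\<close>

text \<open>
  Types cannot depend on numbers, so the prime is passed as the cardinality of a finite
  type, as for the finite prime fields in the AFP: \<open>'p padic\<close> is \<open>\<rat>\<^sub>p\<close> for
  \<open>p = CARD('p)\<close>.
\<close>

class prime_card = finite +
  assumes prime_card: "prime CARD('a)"

definition padic_rel :: "'p::prime_card itself \<Rightarrow> (nat \<Rightarrow> rat) \<Rightarrow> (nat \<Rightarrow> rat) \<Rightarrow> bool" where
  "padic_rel _ X Y \<longleftrightarrow> padic_cauchy CARD('p) X \<and> padic_cauchy CARD('p) Y
     \<and> padic_vanishes CARD('p) (\<lambda>n. X n - Y n)"

lemma padic_rel_refl: "padic_cauchy CARD('p) X \<Longrightarrow> padic_rel TYPE('p::prime_card) X X"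
  by (simp add: padic_rel_def)

lemma part_equivp_padic_rel: "part_equivp (padic_rel TYPE('p::prime_card))"
proof (rule part_equivpI)
  show "\<exists>x. padic_rel TYPE('p) x x"
    using padic_rel_refl[OF padic_cauchy_const] by blast
  show "symp (padic_rel TYPE('p))"
    by (rule sympI) (auto simp: padic_rel_def padic_vanishes_def rat_padic_abs_minus_commute)
  show "transp (padic_rel TYPE('p))"
  proof (rule transpI)
    fix X Y Z assume "padic_rel TYPE('p) X Y" "padic_rel TYPE('p) Y Z"
    then show "padic_rel TYPE('p) X Z"
      unfolding padic_rel_def
      using padic_vanishes_add[OF prime_card[where ?'a = 'p],
          of "\<lambda>n. X n - Y n" "\<lambda>n. Y n - Z n"] by simp
  qed
qed

text \<open>
  Elements are the classes of \<open>p\<close>-adic Cauchy sequences of rationals modulo null sequences.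
  The quotient is set up by hand because the representation type does not mention \<open>'p\<close>,
  which \<open>quotient_type\<close> cannot handle.
\<close>

typedef ('p::prime_card) padic =
  "{C. \<exists>X. padic_rel TYPE('p) X X \<and> C = {Y. padic_rel TYPE('p) X Y}}"
  morphisms padic_class Abs_padic
  using padic_rel_refl[OF padic_cauchy_const] by blast

definition mk_padic :: "(nat \<Rightarrow> rat) \<Rightarrow> 'p::prime_card padic" where
  "mk_padic X = Abs_padic {Y. padic_rel TYPE('p) X Y}"

definition rep_padic :: "'p::prime_card padic \<Rightarrow> nat \<Rightarrow> rat" where
  "rep_padic x = (SOME X. X \<in> padic_class x)"

definition cr_padic :: "(nat \<Rightarrow> rat) \<Rightarrow> 'p::prime_card padic \<Rightarrow> bool" where
  "cr_padic X x \<longleftrightarrow> padic_rel TYPE('p) X X \<and> mk_padic X = x"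

lemma Quotient_padic:
  "Quotient (padic_rel TYPE('p)) mk_padic rep_padic (cr_padic :: _ \<Rightarrow> 'p::prime_card padic \<Rightarrow> bool)"
proof (rule QuotientI)
  let ?R = "padic_rel TYPE('p)"
  note sym = part_equivp_symp[OF part_equivp_padic_rel[where ?'p = 'p]]
  note trans = part_equivp_transp[OF part_equivp_padic_rel[where ?'p = 'p]]
  have refl1: "?R X Y \<Longrightarrow> ?R X X" for X Y
    by (rule trans, assumption, rule sym, assumption)
  have refl2: "?R X Y \<Longrightarrow> ?R Y Y" for X Y
    by (rule trans, rule sym, assumption)
  have class_cong: "{Z. ?R X Z} = {Z. ?R Y Z}" if "?R X Y" for X Y
    using trans[OF sym[OF that]] trans[OF that] by (intro Collect_cong iffI)
  have cls: "padic_class (mk_padic X :: 'p padic) = {Y. ?R X Y}" if "?R X X" for X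
    unfolding mk_padic_def by (rule Abs_padic_inverse, rule CollectI, rule exI[of _ X])
      (use that in simp)
  have rep: "\<exists>X. ?R X X \<and> padic_class a = {Y. ?R X Y}" for a :: "'p padic"
    using padic_class[of a] by (simp only: mem_Collect_eq)
  have repR: "?R (rep_padic a) (rep_padic a) \<and> padic_class a = {Y. ?R (rep_padic a) Y}"
    for a :: "'p padic"
  proof -
    obtain X where X: "?R X X" "padic_class a = {Y. ?R X Y}" using rep by blast
    then have "rep_padic a \<in> padic_class a"
      unfolding rep_padic_def by (metis someI mem_Collect_eq)
    then have "?R X (rep_padic a)" using X by simp
    then show ?thesis using X refl2 class_cong by metis
  qed
  have eqv: "mk_padic X = (mk_padic Y :: 'p padic) \<longleftrightarrow> ?R X Y" if "?R X X" "?R Y Y" for X Y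
  proof -
    have "mk_padic X = (mk_padic Y :: 'p padic) \<longleftrightarrow> {Z. ?R X Z} = {Z. ?R Y Z}"
      using cls[OF that(1)] cls[OF that(2)] by (metis padic_class_inject)
    also have "\<dots> \<longleftrightarrow> ?R X Y" using that class_cong by (metis mem_Collect_eq)
    finally show ?thesis .
  qed
  show "mk_padic (rep_padic a) = a" for a :: "'p padic"
    using repR[of a] by (metis cls padic_class_inject)
  show "?R (rep_padic a) (rep_padic a)" for a :: "'p padic"
    using repR by blast
  show "?R r s = (?R r r \<and> ?R s s \<and> mk_padic r = (mk_padic s :: 'p padic))" for r s
    using eqv refl1 refl2 by metis
  show "cr_padic = (\<lambda>x y :: 'p padic. ?R x x \<and> mk_padic x = y)"
    by (simp add: cr_padic_def fun_eq_iff)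
qed

setup_lifting Quotient_padic

instantiation padic :: (prime_card) field
begin

lift_definition zero_padic :: "'a padic" is "\<lambda>n. 0"
  by (simp add: padic_rel_refl)

lift_definition one_padic :: "'a padic" is "\<lambda>n. 1"
  by (simp add: padic_rel_refl)

lift_definition plus_padic :: "'a padic \<Rightarrow> 'a padic \<Rightarrow> 'a padic" is "\<lambda>X Y n. X n + Y n"
  unfolding padic_rel_def add_diff_add
  by (auto intro: padic_cauchy_add padic_vanishes_add prime_card)

lift_definition uminus_padic :: "'a padic \<Rightarrow> 'a padic" is "\<lambda>X n. - X n"
  unfolding padic_rel_def minus_diff_minus
  by (simp only: padic_cauchy_minus padic_vanishes_minus simp_thms)

lift_definition times_padic :: "'a padic \<Rightarrow> 'a padic \<Rightarrow> 'a padic" is "\<lambda>X Y n. X n * Y n"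
proof -
  fix X X' Y Y' :: "nat \<Rightarrow> rat"
  assume "padic_rel TYPE('a) X X'" "padic_rel TYPE('a) Y Y'"
  then have *: "padic_cauchy CARD('a) X" "padic_cauchy CARD('a) X'"
    "padic_cauchy CARD('a) Y" "padic_cauchy CARD('a) Y'"
    "padic_vanishes CARD('a) (\<lambda>n. X n - X' n)" "padic_vanishes CARD('a) (\<lambda>n. Y n - Y' n)"
    by (auto simp: padic_rel_def)
  note p = prime_card[where ?'a = 'a]
  obtain b where b: "\<And>n. rat_padic_abs CARD('a) (X n) \<le> b"
    using padic_cauchy_bounded[OF p *(1)] by blast
  obtain c where c: "\<And>n. rat_padic_abs CARD('a) (Y' n) \<le> c"
    using padic_cauchy_bounded[OF p *(4)] by blast
  have "padic_vanishes CARD('a) (\<lambda>n. X n * (Y n - Y' n) + Y' n * (X n - X' n))"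
    by (intro padic_vanishes_add padic_vanishes_mult[OF p b] padic_vanishes_mult[OF p c] * p)
  then have "padic_vanishes CARD('a) (\<lambda>n. X n * Y n - X' n * Y' n)"
    by (simp add: algebra_simps)
  then show "padic_rel TYPE('a) (\<lambda>n. X n * Y n) (\<lambda>n. X' n * Y' n)"
    unfolding padic_rel_def by (intro conjI padic_cauchy_mult * p)
qed

lift_definition inverse_padic :: "'a padic \<Rightarrow> 'a padic" is
  "\<lambda>X. if padic_vanishes CARD('a) X then (\<lambda>n. 0) else (\<lambda>n. inverse (X n))"
proof -
  fix X Y :: "nat \<Rightarrow> rat"
  assume "padic_rel TYPE('a) X Y"
  then have *: "padic_cauchy CARD('a) X" "padic_cauchy CARD('a) Y"
    "padic_vanishes CARD('a) (\<lambda>n. X n - Y n)"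
    by (auto simp: padic_rel_def)
  note p = prime_card[where ?'a = 'a]
  have "padic_vanishes CARD('a) X \<longleftrightarrow> padic_vanishes CARD('a) Y"
    using padic_vanishes_add[OF p *(3), of Y]
      padic_vanishes_add[OF p padic_vanishes_minus[OF *(3)], of X] by auto
  then show "padic_rel TYPE('a)
      (if padic_vanishes CARD('a) X then (\<lambda>n. 0) else (\<lambda>n. inverse (X n)))
      (if padic_vanishes CARD('a) Y then (\<lambda>n. 0) else (\<lambda>n. inverse (Y n)))"
    using * p by (simp add: padic_rel_def padic_cauchy_inverse padic_vanishes_diff_inverse)
qed

definition minus_padic :: "'a padic \<Rightarrow> 'a padic \<Rightarrow> 'a padic" where
  "minus_padic x y = x + - y"

definition divide_padic :: "'a padic \<Rightarrow> 'a padic \<Rightarrow> 'a padic" where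
  "divide_padic x y = x * inverse y"

instance
proof
  fix a b c :: "'a padic"
  note p = prime_card[where ?'a = 'a]
  show "a + b + c = a + (b + c)"
    by transfer (simp add: add.assoc padic_rel_def padic_cauchy_add p)
  show "a + b = b + a"
    by transfer (simp add: add.commute padic_rel_def padic_cauchy_add p)
  show "0 + a = a" by transfer (simp add: padic_rel_def)
  show "- a + a = 0" by transfer (simp add: padic_rel_def)
  show "a - b = a + - b" by (rule minus_padic_def)
  show "a * b * c = a * (b * c)"
    by transfer (simp add: mult.assoc padic_rel_def padic_cauchy_mult p)
  show "a * b = b * a"
    by transfer (simp add: mult.commute padic_rel_def padic_cauchy_mult p)
  show "1 * a = a" by transfer (simp add: padic_rel_def)
  show "(a + b) * c = a * c + b * c"
    by transfer (simp add: distrib_right padic_rel_def padic_cauchy_add padic_cauchy_mult p)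
  show "(0 :: 'a padic) \<noteq> 1"
    by transfer (simp add: padic_rel_def padic_vanishes_def rat_padic_abs_minus rat_padic_abs_1
        LIMSEQ_const_iff)
  show "a div b = a * inverse b" by (rule divide_padic_def)
  show "inverse (0 :: 'a padic) = 0" by transfer (simp add: padic_rel_def)
  show "a \<noteq> 0 \<Longrightarrow> inverse a * a = 1"
  proof transfer
    fix X :: "nat \<Rightarrow> rat"
    assume "padic_rel TYPE('a) X X" "\<not> padic_rel TYPE('a) X (\<lambda>n. 0)"
    then have X: "padic_cauchy CARD('a) X" "\<not> padic_vanishes CARD('a) X"
      by (auto simp: padic_rel_def)
    obtain b k where bk: "b > 0" "\<And>n. n \<ge> k \<Longrightarrow> rat_padic_abs CARD('a) (X n) > b"
      using padic_cauchy_not_vanishes[OF p X] by blast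
    then have "inverse (X n) * X n - 1 = 0" if "n \<ge> k" for n
      using bk(2)[OF that] by (cases "X n = 0") auto
    then have "padic_vanishes CARD('a) (\<lambda>n. inverse (X n) * X n - 1)"
      unfolding padic_vanishes_def
      by (intro tendsto_eventually eventually_sequentiallyI[of k]) simp
    then show "padic_rel TYPE('a)
        (\<lambda>n. (if padic_vanishes CARD('a) X then (\<lambda>n. 0) else (\<lambda>n. inverse (X n))) n * X n)
        (\<lambda>n. 1)"
      using X p by (simp add: padic_rel_def padic_cauchy_mult padic_cauchy_inverse)
  qed
qed

end

lift_definition padic_abs :: "'p::prime_card padic \<Rightarrow> real" is
  "\<lambda>X. lim (\<lambda>n. rat_padic_abs CARD('p) (X n))"
proof -
  fix X Y :: "nat \<Rightarrow> rat"
  assume "padic_rel TYPE('p) X Y"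
  then have *: "padic_cauchy CARD('p) X" "padic_cauchy CARD('p) Y"
    "padic_vanishes CARD('p) (\<lambda>n. X n - Y n)"
    by (auto simp: padic_rel_def)
  note p = prime_card[where ?'a = 'p]
  obtain l where l: "(\<lambda>n. rat_padic_abs CARD('p) (X n)) \<longlonglongrightarrow> l"
    using padic_cauchy_abs_convergent[OF p *(1)] by (auto simp: convergent_def)
  have "(\<lambda>n. rat_padic_abs CARD('p) (X n) - rat_padic_abs CARD('p) (Y n)) \<longlonglongrightarrow> 0"
    by (rule Lim_null_comparison[OF _ *(3)[unfolded padic_vanishes_def]])
       (simp add: rat_padic_abs_diff_le[OF p])
  from tendsto_diff[OF l this] have "(\<lambda>n. rat_padic_abs CARD('p) (Y n)) \<longlonglongrightarrow> l" by simp
  from limI[OF l] limI[OF this]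
  show "lim (\<lambda>n. rat_padic_abs CARD('p) (X n)) = lim (\<lambda>n. rat_padic_abs CARD('p) (Y n))"
    by simp
qed

lemma padic_abs_lim:
  assumes "padic_cauchy CARD('p::prime_card) X"
  shows "(\<lambda>n. rat_padic_abs CARD('p) (X n)) \<longlonglongrightarrow> lim (\<lambda>n. rat_padic_abs CARD('p) (X n))"
  using padic_cauchy_abs_convergent[OF prime_card assms] by (simp add: convergent_LIMSEQ_iff)

lemma padic_abs_eq_0_iff: "padic_abs x = 0 \<longleftrightarrow> x = 0"
proof transfer
  fix X :: "nat \<Rightarrow> rat"
  assume "padic_rel TYPE('a) X X"
  then have X: "padic_cauchy CARD('a) X" by (simp add: padic_rel_def)
  show "lim (\<lambda>n. rat_padic_abs CARD('a) (X n)) = 0 \<longleftrightarrow> padic_rel TYPE('a) X (\<lambda>n. 0)"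
    using padic_abs_lim[OF X] limI[of "\<lambda>n. rat_padic_abs CARD('a) (X n)" 0] X
    by (auto simp: padic_rel_def padic_vanishes_def)
qed

lemma padic_abs_minus: "padic_abs (- x) = padic_abs x"
  by transfer (simp add: rat_padic_abs_minus)

lemma padic_abs_ultrametric: "padic_abs (x + y) \<le> max (padic_abs x) (padic_abs y)"
proof transfer
  fix X Y :: "nat \<Rightarrow> rat"
  assume "padic_rel TYPE('a) X X" "padic_rel TYPE('a) Y Y"
  then have X: "padic_cauchy CARD('a) X" and Y: "padic_cauchy CARD('a) Y"
    by (auto simp: padic_rel_def)
  note p = prime_card[where ?'a = 'a]
  show "lim (\<lambda>n. rat_padic_abs CARD('a) (X n + Y n))
      \<le> max (lim (\<lambda>n. rat_padic_abs CARD('a) (X n))) (lim (\<lambda>n. rat_padic_abs CARD('a) (Y n)))"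
    by (rule LIMSEQ_le[OF padic_abs_lim[OF padic_cauchy_add[OF p X Y]]
          tendsto_max[OF padic_abs_lim[OF X] padic_abs_lim[OF Y]]])
       (simp add: rat_padic_abs_ultrametric[OF p])
qed

lemma padic_abs_nonneg: "padic_abs x \<ge> 0"
  using padic_abs_ultrametric[of x "- x"] padic_abs_eq_0_iff[of "x + - x"]
  by (simp add: padic_abs_minus)

instantiation padic :: (prime_card) metric_space
begin

definition dist_padic :: "'a padic \<Rightarrow> 'a padic \<Rightarrow> real" where
  "dist_padic x y = padic_abs (x - y)"

definition uniformity_padic :: "('a padic \<times> 'a padic) filter" where
  "uniformity_padic = (INF e\<in>{0<..}. principal {(x, y). dist x y < e})"

definition open_padic :: "'a padic set \<Rightarrow> bool" where
  "open_padic U \<longleftrightarrow> (\<forall>x\<in>U. \<forall>\<^sub>F (x', y) in uniformity. x' = x \<longrightarrow> y \<in> U)"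

instance
proof
  fix x y z :: "'a padic"
  show "dist x y = 0 \<longleftrightarrow> x = y"
    by (simp add: dist_padic_def padic_abs_eq_0_iff)
  have "padic_abs (x - y) \<le> max (padic_abs (x - z)) (padic_abs (y - z))"
    using padic_abs_ultrametric[of "x - z" "- (y - z)"] by (simp only: padic_abs_minus) simp
  then show "dist x y \<le> dist x z + dist y z"
    unfolding dist_padic_def using padic_abs_nonneg[of "x - z"] padic_abs_nonneg[of "y - z"]
    by linarith
qed (simp_all add: uniformity_padic_def open_padic_def)

end


section \<open>Haar measure and fractional integration\<close>

text \<open>
  Regularity is not required: on a locally compact second countable space it follows from
  finiteness on compact sets. The measure lives on the Borel sets; integrals are meant to be
  taken with respect to its completion, so that all Haar measurable functions are covered,
  as with \<^const>\<open>lborel\<close> and \<^const>\<open>lebesgue\<close>.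
\<close>

definition haar_measure :: "'a::{ab_group_add, t2_space} measure \<Rightarrow> bool" where
  "haar_measure \<mu> \<longleftrightarrow>
     sets \<mu> = sets borel \<and>
     emeasure \<mu> UNIV \<noteq> 0 \<and>
     (\<forall>K. compact K \<longrightarrow> emeasure \<mu> K < \<infinity>) \<and>
     (\<forall>a. \<forall>A\<in>sets borel. emeasure \<mu> ((+) a ` A) = emeasure \<mu> A)"

definition locally_integrable :: "'a::t2_space measure \<Rightarrow> ('a \<Rightarrow> complex) \<Rightarrow> bool" where
  "locally_integrable M f \<longleftrightarrow> (\<forall>K. compact K \<longrightarrow> set_integrable M K f)"

definition padic_frac_const :: "real \<Rightarrow> real \<Rightarrow> real" where
  "padic_frac_const p \<alpha> = (1 - p powr (- \<alpha>)) / (1 - p powr (\<alpha> - 1))"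

definition padic_frac_integral ::
    "'p::prime_card padic measure \<Rightarrow> real \<Rightarrow> ('p padic \<Rightarrow> complex) \<Rightarrow> 'p padic \<Rightarrow> complex" where
  "padic_frac_integral M \<alpha> f x =
     of_real (padic_frac_const (real CARD('p)) \<alpha>) *
     (LINT y:{y. padic_abs y \<le> padic_abs x}|M.
        of_real (padic_abs (x - y) powr (\<alpha> - 1) - padic_abs y powr (\<alpha> - 1)) * f y)"

text \<open>The series over \<open>k \<ge> 1\<close> is indexed by \<open>k = Suc j\<close>.\<close>

definition padic_frac_coeff :: "real \<Rightarrow> real \<Rightarrow> real \<Rightarrow> real" where
  "padic_frac_coeff p \<alpha> m =
     (p powr (- \<alpha> + 1) - 1) / ((1 - p powr (- \<alpha>)) * p) +
     (1 - 1 / p) *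
       (\<Sum>j. (1 - p powr (- real (Suc j) * (\<alpha> - 1))) * p powr (- real (Suc j) * (m + 1)))"

end

theory Submission
  imports Defs "HOL-Number_Theory.Cong"
begin

text \<open>
  Let \<open>r = |x|\<close>. On the ball \<open>|y| \<le> r\<close> the kernel
  \<open>K y = |x - y|\<^sup>\<alpha>\<^sup>-\<^sup>1 - |y|\<^sup>\<alpha>\<^sup>-\<^sup>1\<close> is bounded by \<open>r\<^sup>\<alpha>\<^sup>-\<^sup>1\<close> and the ball has measure \<open>r\<close>,
  so a remainder \<open>o(|y|\<^sup>L)\<close> of \<open>f\<close> contributes \<open>o(r\<^sup>L\<^sup>+\<^sup>\<alpha>)\<close>. The powers \<open>|y|\<^sup>M\<close> are integrated
  exactly: by the ultrametric inequality
  \<open>K y |y|\<^sup>M = |y|\<^sup>M (r\<^sup>\<alpha>\<^sup>-\<^sup>1 - |y|\<^sup>\<alpha>\<^sup>-\<^sup>1) + r\<^sup>M (|y - x|\<^sup>\<alpha>\<^sup>-\<^sup>1 - r\<^sup>\<alpha>\<^sup>-\<^sup>1)\<close>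
  (the second summand vanishes for \<open>|y| < r\<close>, the first one for \<open>|y| = r\<close>), and both summands are
  radial, about \<open>0\<close> and about \<open>x\<close>, on the same ball. Integrating over spheres turns the first into
  the series in \<open>b\<^sub>n\<close> and the second into a difference of two geometric series. Local
  integrability of \<open>f\<close> only yields integrability on balls because these are compact.
\<close>

section \<open>Topology of the \<open>p\<close>-adic numbers\<close>

lift_definition padic_of_rat :: "rat \<Rightarrow> 'p::prime_card padic" is "\<lambda>q n. q"
  by (simp add: padic_rel_refl)

lemma padic_of_rat_diff: "padic_of_rat (a - b) = (padic_of_rat a - padic_of_rat b :: 'p::prime_card padic)"
proof -
  have "padic_of_rat (a + - b) = (padic_of_rat a + - padic_of_rat b :: 'p padic)"
    by transfer (simp add: padic_rel_refl)
  then show ?thesis by simp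
qed

lemma padic_abs_of_rat: "padic_abs (padic_of_rat q :: 'p::prime_card padic) = rat_padic_abs CARD('p) q"
  by transfer (simp add: limI)

text \<open>A late term of a Cauchy sequence representing \<open>x\<close> serves as the
  approximant. Limits preserve only \<le>, hence the detour through \<open>e / 2\<close>.\<close>

lemma padic_of_rat_dense:
  fixes x :: "'p::prime_card padic"
  assumes "e > 0"
  obtains q where "padic_abs (x - padic_of_rat q) < e"
proof -
  have "\<exists>q. padic_abs (x + - padic_of_rat q) \<le> e / 2"
    using assms
  proof (transfer fixing: e)
    fix X :: "nat \<Rightarrow> rat"
    assume "padic_rel TYPE('p) X X"
    then have X: "padic_cauchy CARD('p) X" by (simp add: padic_rel_def)
    from assms have "e / 2 > 0" by simp
    then obtain k where k: "\<And>m n. m \<ge> k \<Longrightarrow> n \<ge> k \<Longrightarrow> rat_padic_abs CARD('p) (X m - X n) < e / 2"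
      using X unfolding padic_cauchy_def by blast
    have "padic_cauchy CARD('p) (\<lambda>n. X n + - X k)"
      by (intro padic_cauchy_add X prime_card) simp
    from padic_abs_lim[OF this] have "lim (\<lambda>n. rat_padic_abs CARD('p) (X n + - X k)) \<le> e / 2"
      by (rule LIMSEQ_le_const2) (use k in \<open>force intro: less_imp_le\<close>)
    then show "\<exists>q. lim (\<lambda>n. rat_padic_abs CARD('p) (X n + - q)) \<le> e / 2" by blast
  qed
  then obtain q where "padic_abs (x - padic_of_rat q) \<le> e / 2" by auto
  moreover have "e / 2 < e" using assms by simp
  ultimately show ?thesis using that by (meson le_less_trans)
qed

lemma padic_abs_minus_commute: "padic_abs (x - y) = padic_abs (y - x)"
  using padic_abs_minus[of "x - y"] by simp

lemma padic_abs_diff_ultrametric: "padic_abs (x - y) \<le> max (padic_abs x) (padic_abs y)"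
  using padic_abs_ultrametric[of x "- y"] by (simp add: padic_abs_minus)

lemma padic_abs_diff_trans: "padic_abs (x - z) \<le> max (padic_abs (x - y)) (padic_abs (y - z))"
  using padic_abs_ultrametric[of "x - y" "y - z"] by simp

text \<open>Ultrametric triangles are isosceles: in \<open>x = (x - y) + y\<close> the maximum
  bounding \<open>padic_abs x\<close> cannot come from the smaller \<open>y\<close>.\<close>

lemma padic_abs_diff_eq:
  assumes "padic_abs y < padic_abs x"
  shows "padic_abs (x - y) = padic_abs x"
  using padic_abs_diff_ultrametric[of x y] padic_abs_ultrametric[of "x - y" y] assms by auto

lemma padic_abs_0 [simp]: "padic_abs 0 = 0"
  by (simp add: padic_abs_eq_0_iff)

lemma CARD_prime_card_gt_1: "real CARD('p::prime_card) > 1"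
  using prime_gt_1_nat[OF prime_card[where ?'a = 'p]] by linarith

section \<open>The value group\<close>

text \<open>A rational closer to \<open>x\<close> than \<open>padic_abs x\<close> has the same
  absolute value, so completing the rationals creates no new values.\<close>

lemma padic_abs_values:
  fixes x :: "'p::prime_card padic"
  assumes "x \<noteq> 0"
  obtains k :: int where "padic_abs x = real CARD('p) powi k"
proof -
  have "padic_abs x > 0"
    using assms padic_abs_nonneg[of x] padic_abs_eq_0_iff[of x] by linarith
  then obtain q where q: "padic_abs (x - padic_of_rat q) < padic_abs x"
    using padic_of_rat_dense by blast
  \<comment> \<open>The isosceles principle is applied to \<open>x\<close> and
    \<open>x - padic_of_rat q\<close>, whose difference is the rational itself.\<close>
  from padic_abs_diff_eq[OF this] have eq: "padic_abs x = rat_padic_abs CARD('p) q"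
    by (simp add: padic_abs_of_rat)
  then have "q \<noteq> 0" using \<open>padic_abs x > 0\<close> by auto
  then show ?thesis using that eq by (auto simp: rat_padic_abs_def)
qed

text \<open>The value \<open>p / p^m\<close> is the next one above \<open>1 / p^m\<close>, so the
  strict bound already forces the exponent to be at most \<open>- m\<close>.\<close>

lemma padic_abs_le_power_cases:
  fixes x :: "'p::prime_card padic"
  assumes "x \<noteq> 0" "padic_abs x < real CARD('p) / real CARD('p) ^ m"
  obtains k where "padic_abs x = 1 / real CARD('p) ^ (m + k)"
proof -
  note p = CARD_prime_card_gt_1[where 'p='p]
  obtain i where i: "padic_abs x = real CARD('p) powi i"
    using padic_abs_values[OF assms(1)] .
  have "real CARD('p) powi i < real CARD('p) powi (1 - int m)"
    using assms(2) p unfolding i by (simp add: power_int_diff)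
  then have "i < 1 - int m"
    using p by (meson power_int_increasing not_le less_imp_le)
  then have "i = - int (m + nat (- i - int m))" by simp
  then obtain k where "i = - int (m + k)" by blast
  then have "padic_abs x = 1 / real CARD('p) ^ (m + k)"
    unfolding i by (simp only: power_int_minus power_int_of_nat inverse_eq_divide)
  then show ?thesis by (rule that)
qed

section \<open>Completeness\<close>

text \<open>Each \<open>X n\<close> is replaced by a rational \<open>Q n\<close> within
  \<open>1 / (n + 1)\<close>. The sequence \<open>Q\<close> is again Cauchy, and its class in the
  quotient is the limit of \<open>X\<close>.\<close>

instance padic :: (prime_card) complete_space
proof
  fix X :: "nat \<Rightarrow> 'a padic"
  assume X: "Cauchy X"
  note p = prime_card[where ?'a = 'a]
  have "\<exists>q. padic_abs (X n - padic_of_rat q) < inverse (real (Suc n))" for n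
    by (rule padic_of_rat_dense[of "inverse (real (Suc n))" "X n"]) auto
  then obtain Q where Q: "\<And>n. padic_abs (X n - padic_of_rat (Q n)) < inverse (real (Suc n))"
    by metis
  have small: "\<exists>k. \<forall>n\<ge>k. padic_abs (X n - padic_of_rat (Q n)) < e" if "e > 0" for e
  proof -
    obtain k where k: "inverse (real (Suc k)) < e" using reals_Archimedean \<open>e > 0\<close> by blast
    have "padic_abs (X n - padic_of_rat (Q n)) < e" if "n \<ge> k" for n
    proof -
      have "inverse (real (Suc n)) \<le> inverse (real (Suc k))"
        using that by (intro le_imp_inverse_le) auto
      then show ?thesis using Q[of n] k by linarith
    qed
    then show ?thesis by blast
  qed
  have cau: "padic_cauchy CARD('a) Q"
    unfolding padic_cauchy_def
  proof (intro allI impI)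
    fix e :: real assume e: "e > 0"
    obtain i where i: "\<And>m n. m \<ge> i \<Longrightarrow> n \<ge> i \<Longrightarrow> padic_abs (X m - X n) < e"
      using metric_CauchyD[OF X e] unfolding dist_padic_def by blast
    obtain j where j: "\<And>n. n \<ge> j \<Longrightarrow> padic_abs (X n - padic_of_rat (Q n)) < e"
      using small[OF e] by blast
    have "rat_padic_abs CARD('a) (Q m - Q n) < e" if "m \<ge> max i j" "n \<ge> max i j" for m n
    proof -
      have "padic_abs (padic_of_rat (Q m) - padic_of_rat (Q n) :: 'a padic) < e"
        using padic_abs_diff_trans[of "padic_of_rat (Q m)" "padic_of_rat (Q n)" "X m"]
          padic_abs_diff_trans[of "X m" "padic_of_rat (Q n)" "X n"]
          j[of m] j[of n] i[of m n] that
        by (simp add: padic_abs_minus_commute[of "padic_of_rat (Q m)" "X m"])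
      then show ?thesis by (simp flip: padic_of_rat_diff add: padic_abs_of_rat)
    qed
    then show "\<exists>k. \<forall>m\<ge>k. \<forall>n\<ge>k. rat_padic_abs CARD('a) (Q m - Q n) < e" by blast
  qed
  define x :: "'a padic" where "x = mk_padic Q"
  have Qx: "\<exists>k. \<forall>n\<ge>k. padic_abs (padic_of_rat (Q n) - x) < e" if e: "e > 0" for e
  proof -
    from e have "e / 2 > 0" by simp
    then obtain k where k: "\<And>m n. m \<ge> k \<Longrightarrow> n \<ge> k \<Longrightarrow> rat_padic_abs CARD('a) (Q m - Q n) < e / 2"
      using cau unfolding padic_cauchy_def by blast
    have "padic_abs (padic_of_rat (Q n) - x) < e" if "n \<ge> k" for n
    proof -
      \<comment> \<open>The difference \<open>padic_of_rat (Q n) - x\<close> is the class of the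
        sequence \<open>Q n - Q i\<close> in \<open>i\<close>, so its absolute value is a limit of
        rational ones.\<close>
      have c: "padic_cauchy CARD('a) (\<lambda>i. Q n + - Q i)"
        by (intro padic_cauchy_add padic_cauchy_minus cau p) simp
      have "padic_of_rat (Q n) - x = mk_padic (\<lambda>i. Q n + - Q i)"
        unfolding x_def minus_padic_def padic_of_rat_def
        by (simp add: uminus_padic.abs_eq plus_padic.abs_eq padic_rel_refl padic_cauchy_minus cau)
      then have "padic_abs (padic_of_rat (Q n) - x) = lim (\<lambda>i. rat_padic_abs CARD('a) (Q n + - Q i))"
        by (simp add: padic_abs.abs_eq padic_rel_refl c del: add_uminus_conv_diff)
      also have "\<dots> \<le> e / 2"
        by (rule LIMSEQ_le_const2[OF padic_abs_lim[OF c]]) (use k that in \<open>force intro: less_imp_le\<close>)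
      finally show ?thesis using e by simp
    qed
    then show ?thesis by blast
  qed
  have "X \<longlonglongrightarrow> x"
  proof (rule metric_LIMSEQ_I)
    fix e :: real assume e: "e > 0"
    obtain i where i: "\<And>n. n \<ge> i \<Longrightarrow> padic_abs (X n - padic_of_rat (Q n)) < e"
      using small[OF e] by blast
    obtain j where j: "\<And>n. n \<ge> j \<Longrightarrow> padic_abs (padic_of_rat (Q n) - x) < e"
      using Qx[OF e] by blast
    have "dist (X n) x < e" if "n \<ge> max i j" for n
      using padic_abs_diff_trans[of "X n" x "padic_of_rat (Q n)"] i[of n] j[of n] that
      by (simp add: dist_padic_def)
    then show "\<exists>no. \<forall>n\<ge>no. dist (X n) x < e" by blast
  qed
  then show "convergent X" by (auto simp: convergent_def)
qed

section \<open>Residues modulo powers of p\<close>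

text \<open>A nonzero integer has absolute value \<open>p^(-v)\<close> with \<open>v\<close> its
  multiplicity, so closeness of integers becomes congruence modulo \<open>p^k\<close>.\<close>

lemma rat_padic_abs_of_int_le:
  assumes p: "prime p"
  shows "rat_padic_abs p (of_int z) \<le> 1 / real p ^ k \<longleftrightarrow> int p ^ k dvd z"
proof (cases "z = 0")
  case False
  have p1: "real p > 1" using p prime_gt_1_nat[of p] by simp
  have "rat_padic_abs p (of_int z) = 1 / real p ^ multiplicity (int p) z"
    using rat_padic_abs_frac[OF p False, of 1] by (simp add: power_int_minus field_simps)
  moreover have "1 / real p ^ multiplicity (int p) z \<le> 1 / real p ^ k \<longleftrightarrow> k \<le> multiplicity (int p) z"
    using p1 by (simp add: frac_le_eq field_simps)
  moreover have "k \<le> multiplicity (int p) z \<longleftrightarrow> int p ^ k dvd z"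
    using False prime_gt_1_nat[OF p] by (intro power_dvd_iff_le_multiplicity[symmetric]) auto
  ultimately show ?thesis by simp
qed simp

text \<open>A fraction \<open>c / d\<close> in lowest terms with absolute value at most 1 has
  \<open>d\<close> prime to \<open>p\<close>. Hence \<open>d\<close> is invertible modulo
  \<open>p^k\<close>, and \<open>j\<close> is the residue of \<open>c / d\<close>.\<close>

lemma rat_padic_approx_nat:
  assumes p: "prime p" and q: "rat_padic_abs p q \<le> 1"
  obtains j where "j < p ^ k" "rat_padic_abs p (q - of_nat j) \<le> 1 / real p ^ k"
proof -
  have p1: "real p > 1" using p prime_gt_1_nat[of p] by simp
  obtain c d where cd: "quotient_of q = (c, d)" by fastforce
  have d: "d > 0" using quotient_of_denom_pos[OF cd] .
  have qcd: "q = of_int c / of_int d" using quotient_of_div[OF cd] .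
  have cop: "coprime c d" using quotient_of_coprime[OF cd] .
  have nd: "\<not> int p dvd d"
  proof
    assume pd: "int p dvd d"
    then have pc: "\<not> int p dvd c"
      using cop p by (meson coprime_common_divisor not_prime_unit prime_int_nat_transfer prime_nat_int_transfer)
    \<comment> \<open>If \<open>p\<close> divided \<open>d\<close>, then |c| = |q| |d| would be at
      most \<open>1 / p\<close>, and \<open>p\<close> would divide \<open>c\<close> as well.\<close>
    have "rat_padic_abs p (of_int c) = rat_padic_abs p q * rat_padic_abs p (of_int d)"
      using d by (simp add: qcd flip: rat_padic_abs_mult[OF p])
    also have "\<dots> \<le> 1 * (1 / real p ^ 1)"
      using q rat_padic_abs_of_int_le[OF p, of d 1] pd by (intro mult_mono) auto
    finally have "int p ^ 1 dvd c"
      using rat_padic_abs_of_int_le[OF p, of c 1] by simp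
    then show False using pc by simp
  qed
  have absd: "rat_padic_abs p (of_int d) = 1"
    using rat_padic_abs_frac[OF p, of d 1] d nd by (simp add: not_dvd_imp_multiplicity_0)
  have "prime (int p)" using p by simp
  then have "coprime (int p) d" using nd by (rule prime_imp_coprime)
  then have "coprime d (int p ^ k)" by (simp add: coprime_commute)
  then obtain y where "[d * y = 1] (mod int p ^ k)"
    using cong_solve_coprime_int[of d "int p ^ k"] by blast
  then have "[c * (d * y) = c * 1] (mod int p ^ k)" by (rule cong_scalar_left)
  then have "[d * (c * y) = c] (mod int p ^ k)" by (simp add: mult.left_commute)
  then obtain x where x: "[d * x = c] (mod int p ^ k)" ..
  define j where "j = nat (x mod int p ^ k)"
  have pk: "int p ^ k > 0" using p1 by simp
  have j: "int j = x mod int p ^ k" using pk by (simp add: j_def)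
  have "int j < int p ^ k" unfolding j using pk by simp
  then have "j < p ^ k" by (metis of_nat_less_iff of_nat_power)
  moreover have "int p ^ k dvd c - d * int j"
  proof -
    have "[d * int j = c] (mod int p ^ k)"
      unfolding j using x by (simp add: cong_def mod_mult_right_eq)
    then show ?thesis by (metis cong_iff_dvd_diff cong_sym)
  qed
  then have "rat_padic_abs p (of_int (c - d * int j)) \<le> 1 / real p ^ k"
    using rat_padic_abs_of_int_le[OF p] by blast
  \<comment> \<open>Since |d| = 1, the error \<open>q - of_nat j\<close> has the absolute value of
    its numerator \<open>c - d * int j\<close>.\<close>
  moreover have "rat_padic_abs p (of_int (c - d * int j)) = rat_padic_abs p (q - of_nat j)"
  proof -
    have "of_int (c - d * int j) = (q - of_nat j) * of_int d"
      using d by (simp add: qcd field_simps)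
    then show ?thesis by (simp only: rat_padic_abs_mult[OF p] absd)
  qed
  ultimately show ?thesis using that by simp
qed

text \<open>Density reduces the claim to a rational that is still in the unit ball. The residues
  below \<open>p^k\<close> thus become centres of a finite cover of that ball.\<close>

lemma padic_approx_nat:
  fixes x :: "'p::prime_card padic"
  assumes "padic_abs x \<le> 1"
  obtains j where "j < CARD('p) ^ k"
    "padic_abs (x - padic_of_rat (of_nat j)) \<le> 1 / real CARD('p) ^ k"
proof -
  note p = prime_card[where ?'a = 'p] and p1 = CARD_prime_card_gt_1[where 'p = 'p]
  have "1 / real CARD('p) ^ k > 0" using p1 by simp
  then obtain q where q: "padic_abs (x - padic_of_rat q) < 1 / real CARD('p) ^ k"
    using padic_of_rat_dense by blast
  have le1: "1 / real CARD('p) ^ k \<le> 1" using p1 by (simp add: one_le_power)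
  have "padic_abs (padic_of_rat q :: 'p padic) \<le> 1"
    using padic_abs_diff_ultrametric[of x "x - padic_of_rat q"] less_le_trans[OF q le1] assms
    by auto
  then obtain j where j: "j < CARD('p) ^ k" "rat_padic_abs CARD('p) (q - of_nat j) \<le> 1 / real CARD('p) ^ k"
    using rat_padic_approx_nat[OF p] unfolding padic_abs_of_rat by blast
  have "padic_abs (padic_of_rat q - padic_of_rat (of_nat j) :: 'p padic) \<le> 1 / real CARD('p) ^ k"
    using j(2) by (simp flip: padic_of_rat_diff add: padic_abs_of_rat)
  then have "padic_abs (x - padic_of_rat (of_nat j)) \<le> 1 / real CARD('p) ^ k"
    using padic_abs_diff_trans[of x "padic_of_rat (of_nat j)" "padic_of_rat q"] q by simp
  then show ?thesis using that j(1) by blast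
qed

text \<open>Two numbers below \<open>p^k\<close> that are congruent modulo \<open>p^k\<close>
  coincide. This makes the balls around the residues disjoint.\<close>

lemma padic_of_nat_separated:
  assumes ij: "i < CARD('p) ^ k" "j < CARD('p) ^ k"
    and le: "padic_abs (padic_of_rat (of_nat i) - padic_of_rat (of_nat j) :: 'p::prime_card padic) \<le> 1 / real CARD('p) ^ k"
  shows "i = j"
proof -
  have "rat_padic_abs CARD('p) (of_int (int i - int j)) \<le> 1 / real CARD('p) ^ k"
    using le by (simp flip: padic_of_rat_diff add: padic_abs_of_rat)
  then have "int CARD('p) ^ k dvd int i - int j"
    using rat_padic_abs_of_int_le[OF prime_card[where ?'a = 'p]] by blast
  moreover have "\<bar>int i - int j\<bar> < int (CARD('p) ^ k)" using ij by linarith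
  ultimately have "int i - int j = 0"
    by (metis dvd_imp_le_int not_le of_nat_power abs_of_nat)
  then show ?thesis by simp
qed

section \<open>Compactness of balls\<close>

lemma continuous_on_padic_abs: "continuous_on S (padic_abs :: 'p::prime_card padic \<Rightarrow> real)"
proof -
  have "continuous_on S (\<lambda>x :: 'p padic. dist x 0)" by (intro continuous_intros)
  then show ?thesis by (simp add: dist_padic_def)
qed

text \<open>The ball is closed in a complete space, and totally bounded because the
  \<open>p^k\<close> residues form a net of mesh \<open>1 / p^k\<close>.\<close>

lemma compact_padic_unit_ball: "compact {x :: 'p::prime_card padic. padic_abs x \<le> 1}"
proof -
  let ?B = "{x :: 'p padic. padic_abs x \<le> 1}"
  note p1 = CARD_prime_card_gt_1[where 'p = 'p]
  have "?B = cball 0 1" by (auto simp: dist_padic_def padic_abs_minus)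
  then have "complete ?B" by (simp add: complete_eq_closed)
  moreover have "\<exists>K. finite K \<and> ?B \<subseteq> (\<Union>x\<in>K. ball x e)" if e: "e > 0" for e
  proof -
    obtain k where k: "(1 / real CARD('p)) ^ k < e"
      using real_arch_pow_inv[OF e, of "1 / real CARD('p)"] p1 by auto
    let ?K = "(\<lambda>j. padic_of_rat (of_nat j) :: 'p padic) ` {..<CARD('p) ^ k}"
    have "?B \<subseteq> (\<Union>x\<in>?K. ball x e)"
    proof
      fix x assume "x \<in> ?B"
      then obtain j where "j < CARD('p) ^ k" "padic_abs (x - padic_of_rat (of_nat j)) \<le> 1 / real CARD('p) ^ k"
        using padic_approx_nat by blast
      then show "x \<in> (\<Union>x\<in>?K. ball x e)"
        using k by (force simp: dist_padic_def padic_abs_minus_commute power_one_over)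
    qed
    then show ?thesis by blast
  qed
  ultimately show ?thesis by (simp add: compact_eq_totally_bounded)
qed

lemma compact_padic_ball:
  assumes "r \<le> 1"
  shows "compact {x :: 'p::prime_card padic. padic_abs x \<le> r}"
proof -
  have "closed {x :: 'p padic. padic_abs x \<le> r}"
    by (intro closed_Collect_le continuous_on_padic_abs continuous_on_const)
  then have "compact ({x :: 'p padic. padic_abs x \<le> 1} \<inter> {x. padic_abs x \<le> r})"
    by (intro compact_Int_closed compact_padic_unit_ball)
  moreover have "{x :: 'p padic. padic_abs x \<le> 1} \<inter> {x. padic_abs x \<le> r} = {x. padic_abs x \<le> r}"
    using assms by auto
  ultimately show ?thesis by simp
qed

section \<open>Haar measure of balls and radial integrals\<close>

lemma borel_measurable_padic_abs_diff [measurable]: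
  "(\<lambda>y :: 'p::prime_card padic. padic_abs (y - c)) \<in> borel_measurable borel"
proof -
  have "continuous_on UNIV (\<lambda>y :: 'p padic. dist y c)" by (intro continuous_intros)
  then show ?thesis unfolding dist_padic_def by (rule borel_measurable_continuous_onI)
qed

lemma borel_measurable_padic_abs [measurable]:
  "(padic_abs :: 'p::prime_card padic \<Rightarrow> real) \<in> borel_measurable borel"
  using borel_measurable_padic_abs_diff[of 0] by simp

lemma padic_ball_translate:
  "{y :: 'p::prime_card padic. padic_abs (y - c) \<le> r} = (+) c ` {y. padic_abs y \<le> r}"
proof (intro equalityI subsetI)
  fix y assume "y \<in> {y. padic_abs (y - c) \<le> r}"
  then show "y \<in> (+) c ` {y. padic_abs y \<le> r}" by (intro image_eqI[of _ _ "y - c"]) auto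
qed auto

text \<open>Every point of an ultrametric ball is a centre of it. This permits radial integration
  about \<open>x\<close> over a ball given about 0.\<close>

lemma padic_ball_recenter:
  assumes "padic_abs x \<le> r"
  shows "{y. padic_abs (y - x) \<le> r} = {y. padic_abs y \<le> r}"
proof (intro Collect_cong iffI)
  fix y
  show "padic_abs (y - x) \<le> r" if "padic_abs y \<le> r"
    using assms that padic_abs_diff_ultrametric[of y x] by linarith
  show "padic_abs y \<le> r" if "padic_abs (y - x) \<le> r"
    using assms that padic_abs_ultrametric[of "y - x" x] by simp
qed

text \<open>By discreteness of the values a punctured ball splits into countably many spheres; the
  centre belongs to none of them.\<close>

lemma padic_abs_dist_sphere_cases:
  fixes y c :: "'p::prime_card padic"
  assumes "y \<noteq> c" "padic_abs (y - c) \<le> 1 / real CARD('p) ^ m"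
  obtains k where "padic_abs (y - c) = 1 / real CARD('p) ^ (m + k)"
proof -
  have "1 / real CARD('p) ^ m < real CARD('p) / real CARD('p) ^ m"
    using CARD_prime_card_gt_1[where 'p = 'p] by (intro divide_strict_right_mono) auto
  then show ?thesis
    using padic_abs_le_power_cases[of "y - c" m] assms that by (meson eq_iff_diff_eq_0 le_less_trans)
qed

lemma inverse_power_le_iff:
  fixes b :: real
  assumes "b > 1"
  shows "1 / b ^ m \<le> 1 / b ^ n \<longleftrightarrow> n \<le> m"
  using assms by (simp add: divide_le_eq pos_divide_le_eq pos_le_divide_eq)

section \<open>Measures of balls, spheres and points\<close>

locale padic_haar =
  fixes \<mu> :: "'p::prime_card padic measure"
  assumes haar: "haar_measure \<mu>"
    and normalized: "emeasure \<mu> {x. padic_abs x \<le> 1} = 1"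
begin

lemma p_gt_1: "real CARD('p) > 1"
  by (rule CARD_prime_card_gt_1)

lemma sets_haar [measurable_cong, simp]: "sets \<mu> = sets borel"
  using haar by (simp add: haar_measure_def)

lemma space_haar [simp]: "space \<mu> = UNIV"
  using sets_eq_imp_space_eq[OF sets_haar] by simp

lemma padic_ball_sets [measurable, simp]: "{y. padic_abs (y - c) \<le> r} \<in> sets borel"
  by measurable

lemma emeasure_translate_ball:
  "emeasure \<mu> {y. padic_abs (y - c) \<le> r} = emeasure \<mu> {y. padic_abs y \<le> r}"
  unfolding padic_ball_translate
  using haar padic_ball_sets[of 0 r] by (simp add: haar_measure_def)

text \<open>The unit ball is the disjoint union of \<open>p^k\<close> balls around the residues. By
  translation invariance all have the same measure \<open>e\<close>, whence
  \<open>p^k * e = 1\<close>.\<close>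

lemma emeasure_ball: "emeasure \<mu> {y. padic_abs (y - c) \<le> 1 / real CARD('p) ^ k} = ennreal (1 / real CARD('p) ^ k)"
proof -
  define e where "e = emeasure \<mu> {y. padic_abs y \<le> 1 / real CARD('p) ^ k}"
  let ?F = "\<lambda>j. {y :: 'p padic. padic_abs (y - padic_of_rat (of_nat j)) \<le> 1 / real CARD('p) ^ k}"
  let ?I = "{..<CARD('p) ^ k}"
  have k1: "1 / real CARD('p) ^ k \<le> 1" using p_gt_1 by (simp add: one_le_power)
  have cover: "(\<Union>j\<in>?I. ?F j) = {y. padic_abs y \<le> 1}"
  proof (intro equalityI subsetI)
    fix y assume "y \<in> {y :: 'p padic. padic_abs y \<le> 1}"
    then show "y \<in> (\<Union>j\<in>?I. ?F j)" using padic_approx_nat[of y k] by blast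
  next
    fix y assume "y \<in> (\<Union>j\<in>?I. ?F j)"
    then obtain j where j: "padic_abs (y - padic_of_rat (of_nat j)) \<le> 1 / real CARD('p) ^ k" by blast
    \<comment> \<open>Exponent 0 in the divisibility criterion: every integer has absolute value at
      most 1.\<close>
    have "padic_abs (padic_of_rat (of_nat j) :: 'p padic) \<le> 1"
      using rat_padic_abs_of_int_le[OF prime_card[where ?'a = 'p], of "int j" 0]
      by (simp add: padic_abs_of_rat)
    then show "y \<in> {y. padic_abs y \<le> 1}"
      using padic_abs_ultrametric[of "y - padic_of_rat (of_nat j)" "padic_of_rat (of_nat j)"]
        order_trans[OF j k1] by auto
  qed
  have "disjoint_family_on ?F ?I"
  proof (unfold disjoint_family_on_def, intro ballI impI, rule ccontr)
    fix i j assume ij: "i \<in> ?I" "j \<in> ?I" "i \<noteq> j" and "?F i \<inter> ?F j \<noteq> {}"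
    then obtain y where y: "y \<in> ?F i" "y \<in> ?F j" by blast
    have "padic_abs (padic_of_rat (of_nat i) - padic_of_rat (of_nat j) :: 'p padic) \<le> 1 / real CARD('p) ^ k"
      using padic_abs_diff_trans[of "padic_of_rat (of_nat i)" "padic_of_rat (of_nat j)" y] y
      by (simp add: padic_abs_minus_commute[of _ y])
    then show False using padic_of_nat_separated ij by blast
  qed
  then have "(\<Sum>j\<in>?I. emeasure \<mu> (?F j)) = emeasure \<mu> (\<Union>j\<in>?I. ?F j)"
    by (intro sum_emeasure) auto
  then have *: "of_nat (CARD('p) ^ k) * e = 1"
    unfolding cover normalized emeasure_translate_ball e_def[symmetric] by simp
  have pk: "real CARD('p) ^ k > 0" using p_gt_1 by simp
  \<comment> \<open>Finiteness of \<open>e\<close> lets the equation be solved in the reals.\<close>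
  have "e \<le> 1"
    unfolding e_def normalized[symmetric] using order_trans[OF _ k1] by (intro emeasure_mono) auto
  then obtain r where r: "e = ennreal r" "r \<ge> 0"
    by (metis ennreal_cases ennreal_one_neq_top top_unique)
  have "ennreal (real CARD('p) ^ k * r) = ennreal 1"
    using * r by (simp add: ennreal_of_nat_eq_real_of_nat flip: ennreal_mult)
  then have "real CARD('p) ^ k * r = 1" using r pk by (subst (asm) ennreal_inj) auto
  then have "r = 1 / real CARD('p) ^ k" using pk by (simp add: field_simps)
  then show ?thesis
    unfolding emeasure_translate_ball e_def[symmetric] r by simp
qed

lemma measure_ball: "measure \<mu> {y. padic_abs (y - c) \<le> 1 / real CARD('p) ^ k} = 1 / real CARD('p) ^ k"
  by (simp add: measure_def emeasure_ball)

text \<open>No value lies strictly between consecutive powers of p, so the sphere is a ball minus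
  the next smaller ball.\<close>

lemma measure_sphere: "measure \<mu> {y. padic_abs (y - c) = 1 / real CARD('p) ^ k} = (1 - 1 / real CARD('p)) / real CARD('p) ^ k"
proof -
  let ?B = "\<lambda>k. {y. padic_abs (y - c) \<le> 1 / real CARD('p) ^ k}"
  note le = inverse_power_le_iff[OF p_gt_1]
  have "{y. padic_abs (y - c) = 1 / real CARD('p) ^ k} = ?B k - ?B (Suc k)"
  proof (intro equalityI subsetI)
    fix y assume y: "y \<in> ?B k - ?B (Suc k)"
    then have "y \<noteq> c" using p_gt_1 by auto
    then obtain j where j: "padic_abs (y - c) = 1 / real CARD('p) ^ (k + j)"
      using y padic_abs_dist_sphere_cases by blast
    then have "j = 0" using y le[of "k + j" "Suc k"] by (cases j) auto
    then show "y \<in> {y. padic_abs (y - c) = 1 / real CARD('p) ^ k}" using j by simp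
  qed (use le[of k "Suc k"] in auto)
  moreover have "measure \<mu> (?B k - ?B (Suc k)) = measure \<mu> (?B k) - measure \<mu> (?B (Suc k))"
    using le[of "Suc k" k] by (intro measure_Diff) (auto simp: emeasure_ball)
  ultimately show ?thesis using p_gt_1 by (simp only: measure_ball) (simp add: field_simps)
qed

text \<open>The point \<open>c\<close> lies in balls of measure \<open>1 / p^k\<close> for every
  \<open>k\<close>.\<close>

lemma AE_neq: "AE y in \<mu>. y \<noteq> c"
proof -
  have "emeasure \<mu> {c} \<le> ennreal (1 / real CARD('p) ^ k)" for k
    unfolding emeasure_ball[of c k, symmetric] using p_gt_1 by (intro emeasure_mono) auto
  moreover have "(\<lambda>k. ennreal (1 / real CARD('p) ^ k)) \<longlonglongrightarrow> ennreal 0"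
    using LIMSEQ_realpow_zero[of "1 / real CARD('p)"] p_gt_1
    by (intro tendsto_ennrealI) (simp add: power_one_over)
  ultimately have "emeasure \<mu> {c} \<le> ennreal 0"
    by (intro LIMSEQ_le_const) auto
  then have "{c} \<in> null_sets \<mu>" by (intro null_setsI) auto
  then show ?thesis using AE_not_in by fastforce
qed

section \<open>Integrals of radial functions\<close>

text \<open>Up to the null set of the centre, the ball is a disjoint union of spheres on which the
  integrand is constant. The bound \<open>C\<close> gives integrability, hence countable additivity,
  and also convergence of the series.\<close>

lemma
  assumes h [measurable]: "h \<in> borel_measurable borel"
    and C: "\<And>t. 0 \<le> t \<Longrightarrow> t \<le> 1 / real CARD('p) ^ m \<Longrightarrow> \<bar>h t\<bar> \<le> C"
  shows set_integrable_radial: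
      "set_integrable \<mu> {y. padic_abs (y - c) \<le> 1 / real CARD('p) ^ m} (\<lambda>y. h (padic_abs (y - c)) :: real)"
    and sums_radial:
      "(\<lambda>k. (1 - 1 / real CARD('p)) / real CARD('p) ^ (m + k) * h (1 / real CARD('p) ^ (m + k))) sums (LINT y:{y. padic_abs (y - c) \<le> 1 / real CARD('p) ^ m}|\<mu>. h (padic_abs (y - c)))"
proof -
  let ?B = "{y. padic_abs (y - c) \<le> 1 / real CARD('p) ^ m}" and ?h = "\<lambda>y. h (padic_abs (y - c))"
  let ?S = "\<lambda>k. {y. padic_abs (y - c) = 1 / real CARD('p) ^ (m + k)}"
  note le = inverse_power_le_iff[OF p_gt_1]
  show int: "set_integrable \<mu> ?B ?h"
    unfolding set_integrable_def
    by (rule integrableI_bounded_set_indicator[where B = C])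
       (auto simp: emeasure_ball padic_abs_nonneg C)
  have S [measurable]: "?S k \<in> sets \<mu>" for k by simp
  have sub: "(\<Union>k. ?S k) \<subseteq> ?B" using le[of "m + k" m for k] by auto
  have "(LINT y:?B|\<mu>. ?h y) = (LINT y:(\<Union>k. ?S k)|\<mu>. ?h y)"
    unfolding set_lebesgue_integral_def
  proof (rule integral_cong_AE)
    show "AE y in \<mu>. indicator ?B y *\<^sub>R ?h y = indicator (\<Union>k. ?S k) y *\<^sub>R ?h y"
      using AE_neq[of c]
    proof eventually_elim
      fix y assume "y \<noteq> c"
      have "y \<in> ?B \<longleftrightarrow> y \<in> (\<Union>k. ?S k)"
      proof
        assume "y \<in> ?B"
        then obtain k where "padic_abs (y - c) = 1 / real CARD('p) ^ (m + k)"
          using padic_abs_dist_sphere_cases[OF \<open>y \<noteq> c\<close>] by auto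
        then show "y \<in> (\<Union>k. ?S k)" by auto
      qed (use sub in auto)
      then show "indicator ?B y *\<^sub>R ?h y = indicator (\<Union>k. ?S k) y *\<^sub>R ?h y"
        by (simp add: indicator_def)
    qed
  qed measurable
  also have "\<dots> = (\<Sum>k. LINT y:?S k|\<mu>. ?h y)"
  proof (rule lebesgue_integral_countable_add)
    show "?S i \<inter> ?S j = {}" if "i \<noteq> j" for i j
      using that le[of "m + i" "m + j"] le[of "m + j" "m + i"] by auto
    show "set_integrable \<mu> (\<Union>k. ?S k) ?h"
      by (rule set_integrable_subset[OF int _ sub]) measurable
  qed simp
  also have "(\<lambda>k. LINT y:?S k|\<mu>. ?h y) =
      (\<lambda>k. (1 - 1 / real CARD('p)) / real CARD('p) ^ (m + k) * h (1 / real CARD('p) ^ (m + k)))"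
  proof
    fix k
    have "(LINT y:?S k|\<mu>. ?h y) = (LINT y:?S k|\<mu>. h (1 / real CARD('p) ^ (m + k)))"
      by (rule set_lebesgue_integral_cong) auto
    also have "\<dots> = measure \<mu> (?S k) * h (1 / real CARD('p) ^ (m + k))"
      by (simp add: set_lebesgue_integral_def)
    finally show "(LINT y:?S k|\<mu>. ?h y) =
        (1 - 1 / real CARD('p)) / real CARD('p) ^ (m + k) * h (1 / real CARD('p) ^ (m + k))"
      by (simp only: measure_sphere)
  qed
  finally have eq: "(LINT y:?B|\<mu>. ?h y) = (\<Sum>k. (1 - 1 / real CARD('p)) / real CARD('p) ^ (m + k) * h (1 / real CARD('p) ^ (m + k)))" .
  \<comment> \<open>The value of the sum in \<open>eq\<close> does not by itself give convergence.
    The bound \<open>C\<close> and the sphere measures yield a geometric majorant of ratio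
    \<open>1 / p\<close>.\<close>
  have "summable (\<lambda>k. (1 - 1 / real CARD('p)) / real CARD('p) ^ (m + k) * h (1 / real CARD('p) ^ (m + k)))"
  proof (rule summable_comparison_test')
    have "summable (\<lambda>k. (1 / real CARD('p)) ^ k)" using p_gt_1 by (intro summable_geometric) auto
    then show "summable (\<lambda>k. (1 - 1 / real CARD('p)) / real CARD('p) ^ m * C * (1 / real CARD('p)) ^ k)" by (rule summable_mult)
    fix k :: nat
    have "\<bar>h (1 / real CARD('p) ^ (m + k))\<bar> \<le> C" using p_gt_1 le[of "m + k" m] by (intro C) auto
    then have "(1 - 1 / real CARD('p)) / real CARD('p) ^ (m + k) * \<bar>h (1 / real CARD('p) ^ (m + k))\<bar> \<le> (1 - 1 / real CARD('p)) / real CARD('p) ^ (m + k) * C"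
      using p_gt_1 by (intro mult_left_mono) auto
    then show "norm ((1 - 1 / real CARD('p)) / real CARD('p) ^ (m + k) * h (1 / real CARD('p) ^ (m + k))) \<le> (1 - 1 / real CARD('p)) / real CARD('p) ^ m * C * (1 / real CARD('p)) ^ k"
      using p_gt_1 by (simp add: abs_mult power_add power_one_over mult.commute mult.left_commute)
  qed
  then show "(\<lambda>k. (1 - 1 / real CARD('p)) / real CARD('p) ^ (m + k) * h (1 / real CARD('p) ^ (m + k))) sums (LINT y:?B|\<mu>. ?h y)"
    unfolding eq by (rule summable_sums)
qed

section \<open>The kernel against a power of the absolute value\<close>

text \<open>Of the two radial pieces, the one about 0 produces the series in
  \<open>padic_frac_coeff\<close> and the one about \<open>x\<close> its closed first term.\<close>

lemma
  assumes x: "padic_abs x = 1 / real CARD('p) ^ m" and \<alpha>: "1 < \<alpha>" and M: "0 \<le> M"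
  shows set_integrable_kernel_power:
      "set_integrable \<mu> {y. padic_abs y \<le> padic_abs x}
         (\<lambda>y. (padic_abs (x - y) powr (\<alpha> - 1) - padic_abs y powr (\<alpha> - 1)) * padic_abs y powr M)"
    and integral_kernel_power:
      "(LINT y:{y. padic_abs y \<le> padic_abs x}|\<mu>.
          (padic_abs (x - y) powr (\<alpha> - 1) - padic_abs y powr (\<alpha> - 1)) * padic_abs y powr M)
       = padic_frac_coeff (real CARD('p)) \<alpha> M * padic_abs x powr (M + \<alpha>)"
proof -
  define P where "P = real CARD('p)"
  define r where "r = padic_abs x"
  let ?B = "{y. padic_abs y \<le> r}"
  let ?K = "\<lambda>y. padic_abs (x - y) powr (\<alpha> - 1) - padic_abs y powr (\<alpha> - 1)"
  let ?h1 = "\<lambda>t. t powr M * (r powr (\<alpha> - 1) - t powr (\<alpha> - 1))"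
  let ?h2 = "\<lambda>t. t powr (\<alpha> - 1) - r powr (\<alpha> - 1)"
  let ?q = "\<lambda>k. P powr (- real k)"
  have P: "P > 1" unfolding P_def by (rule p_gt_1)
  have rm: "r = 1 / P ^ m" using x by (simp add: r_def P_def)
  have r: "r > 0" unfolding rm using P by simp
  \<comment> \<open>Writing the radii as multiples of \<open>r\<close> separates the power of
    \<open>r\<close> from the dependence on \<open>k\<close> in every term below.\<close>
  have rq: "1 / P ^ (m + k) = r * ?q k" for k
    using P by (simp add: rm powr_minus powr_realpow power_add divide_simps)
  \<comment> \<open>As |x| = \<open>r\<close>, the ball may be recentred at \<open>x\<close>, which
    makes the integral \<open>I2\<close> radial.\<close>
  have ball_x: "?B = {y. padic_abs (y - x) \<le> r}"
    using padic_ball_recenter[of x r] by (simp add: r_def)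
  have split: "?K y * padic_abs y powr M
      = ?h1 (padic_abs (y - 0)) + r powr M * ?h2 (padic_abs (y - x))" if "y \<in> ?B" for y
  proof (cases "padic_abs y < r")
    case True
    then have "padic_abs (x - y) = r" unfolding r_def by (rule padic_abs_diff_eq)
    then show ?thesis by (simp add: padic_abs_minus_commute[of y] mult.commute)
  next
    case False
    then have "padic_abs y = r" using that by simp
    then show ?thesis by (simp add: padic_abs_minus_commute[of y] mult.commute)
  qed
  have b1: "\<bar>?h1 t\<bar> \<le> r powr M * r powr (\<alpha> - 1)" if "0 \<le> t" "t \<le> 1 / P ^ m" for t
  proof -
    have "t powr M \<le> r powr M" "t powr (\<alpha> - 1) \<le> r powr (\<alpha> - 1)"
      using that M \<alpha> by (auto simp: rm intro!: powr_mono2)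
    then show ?thesis by (auto simp: abs_mult intro!: mult_mono)
  qed
  have b2: "\<bar>?h2 t\<bar> \<le> r powr (\<alpha> - 1)" if "0 \<le> t" "t \<le> 1 / P ^ m" for t
  proof -
    have "t powr (\<alpha> - 1) \<le> r powr (\<alpha> - 1)" using that \<alpha> by (auto simp: rm intro!: powr_mono2)
    then show ?thesis by auto
  qed
  have m1: "?h1 \<in> borel_measurable borel" and m2: "?h2 \<in> borel_measurable borel" by measurable
  note radial1 = set_integrable_radial[OF m1 b1[unfolded P_def], where c = 0]
    sums_radial[OF m1 b1[unfolded P_def], where c = 0]
  note radial2 = set_integrable_radial[OF m2 b2[unfolded P_def], where c = x]
    sums_radial[OF m2 b2[unfolded P_def], where c = x]
  define I1 where "I1 = (LINT y:?B|\<mu>. ?h1 (padic_abs (y - 0)))"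
  define I2 where "I2 = (LINT y:?B|\<mu>. ?h2 (padic_abs (y - x)))"
  have int1: "set_integrable \<mu> ?B (\<lambda>y. ?h1 (padic_abs (y - 0)))"
    using radial1(1) by (simp add: rm P_def)
  have int2: "set_integrable \<mu> ?B (\<lambda>y. ?h2 (padic_abs (y - x)))"
    unfolding ball_x using radial2(1) by (simp add: rm P_def)
  have s1: "(\<lambda>k. (1 - 1 / P) / P ^ (m + k) * ?h1 (1 / P ^ (m + k))) sums I1"
    unfolding I1_def using radial1(2) by (simp add: rm P_def)
  have s2: "(\<lambda>k. (1 - 1 / P) / P ^ (m + k) * ?h2 (1 / P ^ (m + k))) sums I2"
    unfolding I2_def ball_x using radial2(2) by (simp add: rm P_def)
  have integrable: "set_integrable \<mu> ?B (\<lambda>y. ?h1 (padic_abs (y - 0)) + r powr M * ?h2 (padic_abs (y - x)))"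
    by (intro set_integral_add set_integrable_mult_right int1 int2)
  have "set_integrable \<mu> ?B (\<lambda>y. ?K y * padic_abs y powr M)
      \<longleftrightarrow> set_integrable \<mu> ?B (\<lambda>y. ?h1 (padic_abs (y - 0)) + r powr M * ?h2 (padic_abs (y - x)))"
    by (rule set_integrable_cong) (use split in auto)
  then show "set_integrable \<mu> {y. padic_abs y \<le> padic_abs x} (\<lambda>y. ?K y * padic_abs y powr M)"
    using integrable by (simp add: r_def)
  have "(LINT y:?B|\<mu>. ?K y * padic_abs y powr M)
      = (LINT y:?B|\<mu>. ?h1 (padic_abs (y - 0)) + r powr M * ?h2 (padic_abs (y - x)))"
    by (rule set_lebesgue_integral_cong) (use split padic_ball_sets[of 0 r] in auto)
  also have "\<dots> = I1 + r powr M * I2"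
    unfolding I1_def I2_def
    by (subst set_integral_add(2)) (use int1 int2 in auto)
  also have "I1 = (1 - 1 / P) * r powr (M + \<alpha>) *
      (\<Sum>j. (1 - P powr (- real (Suc j) * (\<alpha> - 1))) * P powr (- real (Suc j) * (M + 1)))"
  proof -
    have "(1 - 1 / P) / P ^ (m + k) * ?h1 (1 / P ^ (m + k)) = (1 - 1 / P) * r powr (M + \<alpha>) *
        ((1 - P powr (- real k * (\<alpha> - 1))) * P powr (- real k * (M + 1)))" for k
    proof -
      have *: "(r * ?q k) powr a = r powr a * P powr (- real k * a)" for a
        using r by (simp add: powr_mult powr_powr)
      have r': "r powr (M + \<alpha>) = r powr M * (r powr (\<alpha> - 1) * r)"
        using r powr_add[of r "\<alpha> - 1" 1] by (simp add: powr_add)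
      have q': "P powr (- real k * (M + 1)) = P powr (- real k * M) * ?q k"
        unfolding powr_add[symmetric] by (simp add: algebra_simps)
      have "(1 - 1 / P) / P ^ (m + k) * ?h1 (1 / P ^ (m + k)) = (1 - 1 / P) * (1 / P ^ (m + k)) * ?h1 (1 / P ^ (m + k))"
        by simp
      also have "\<dots> = (1 - 1 / P) * r powr (M + \<alpha>) *
        ((1 - P powr (- real k * (\<alpha> - 1))) * P powr (- real k * (M + 1)))"
        unfolding rq * r' q' by (simp only: algebra_simps)
      finally show ?thesis .
    qed
    with s1 have "(\<lambda>k. (1 - 1 / P) * r powr (M + \<alpha>) *
        ((1 - P powr (- real k * (\<alpha> - 1))) * P powr (- real k * (M + 1)))) sums I1"
      by simp
    \<comment> \<open>The term for \<open>k = 0\<close>, the sphere |y| = \<open>r\<close>, vanishes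
      because \<open>P powr 0 = 1\<close>; the series may start at \<open>Suc j\<close>.\<close>
    then have "(\<lambda>j. (1 - 1 / P) * r powr (M + \<alpha>) *
        ((1 - P powr (- real (Suc j) * (\<alpha> - 1))) * P powr (- real (Suc j) * (M + 1)))) sums I1"
      using P by (subst sums_Suc_iff) simp
    moreover have c: "(1 - 1 / P) * r powr (M + \<alpha>) \<noteq> 0" using P r by simp
    ultimately have "(\<lambda>j. (1 - P powr (- real (Suc j) * (\<alpha> - 1))) * P powr (- real (Suc j) * (M + 1)))
        sums (I1 / ((1 - 1 / P) * r powr (M + \<alpha>)))"
      by (subst sums_mult_iff[OF c, symmetric]) simp
    then have eq: "(\<Sum>j. (1 - P powr (- real (Suc j) * (\<alpha> - 1))) * P powr (- real (Suc j) * (M + 1)))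
        = I1 / ((1 - 1 / P) * r powr (M + \<alpha>))"
      by (rule sums_unique[symmetric])
    show ?thesis unfolding eq using c by (metis nonzero_mult_div_cancel_left times_divide_eq_right)
  qed
  also have "I2 = r powr \<alpha> * ((P powr (- \<alpha> + 1) - 1) / ((1 - P powr (- \<alpha>)) * P))"
  proof -
    let ?u = "P powr (- \<alpha>)"
    have u: "0 < ?u" "?u < 1" using P \<alpha> by (auto intro: powr_less_one)
    \<comment> \<open>Multiplied by the sphere measure, the distance power in \<open>?h2\<close>
      contributes the ratio \<open>?u\<close> and the constant in it the ratio
      \<open>1 / P\<close>.\<close>
    have terms: "(1 - 1 / P) / P ^ (m + k) * ?h2 (1 / P ^ (m + k))
        = (1 - 1 / P) * r powr \<alpha> * (?u ^ k - (1 / P) ^ k)" for k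
    proof -
      have *: "(r * ?q k) powr a = r powr a * P powr (- real k * a)" for a
        using r by (simp add: powr_mult powr_powr)
      have r': "r powr \<alpha> = r powr (\<alpha> - 1) * r"
        using r powr_add[of r "\<alpha> - 1" 1] by simp
      have u': "?u ^ k = P powr (- real k * (\<alpha> - 1)) * ?q k"
        using P by (simp add: powr_realpow[symmetric] powr_powr powr_add[symmetric] algebra_simps)
      have q': "(1 / P) ^ k = ?q k"
        using P by (simp add: powr_minus powr_realpow power_one_over inverse_eq_divide)
      have "(1 - 1 / P) / P ^ (m + k) * ?h2 (1 / P ^ (m + k)) = (1 - 1 / P) * (1 / P ^ (m + k)) * ?h2 (1 / P ^ (m + k))"
        by simp
      also have "\<dots> = (1 - 1 / P) * r powr \<alpha> * (?u ^ k - (1 / P) ^ k)"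
        unfolding rq * r' u' q' by (simp only: algebra_simps)
      finally show ?thesis .
    qed
    have "(\<lambda>k. ?u ^ k) sums (1 / (1 - ?u))" "(\<lambda>k. (1 / P) ^ k) sums (1 / (1 - 1 / P))"
      using u P by (intro geometric_sums; simp)+
    then have "(\<lambda>k. (1 - 1 / P) * r powr \<alpha> * (?u ^ k - (1 / P) ^ k)) sums
        ((1 - 1 / P) * r powr \<alpha> * (1 / (1 - ?u) - 1 / (1 - 1 / P)))"
      by (intro sums_mult sums_diff)
    then have "I2 = (1 - 1 / P) * r powr \<alpha> * (1 / (1 - ?u) - 1 / (1 - 1 / P))"
      using s2 unfolding terms by (rule sums_unique2[symmetric])
    also have "\<dots> = r powr \<alpha> * ((1 - 1 / P) * (1 / (1 - ?u) - 1 / (1 - 1 / P)))" by simp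
    \<comment> \<open>The left side is \<open>(1 - 1 / P) / (1 - ?u) - 1\<close>, brought to a
      common denominator.\<close>
    also have "(1 - 1 / P) * (1 / (1 - ?u) - 1 / (1 - 1 / P)) = (?u * P - 1) / ((1 - ?u) * P)"
      using P u \<alpha> by (simp add: divide_simps) (simp add: algebra_simps)
    also have "?u * P = P powr (- \<alpha> + 1)" using P powr_add[of P "- \<alpha>" 1] by simp
    finally show ?thesis .
  qed
  also have "(1 - 1 / P) * r powr (M + \<alpha>) *
        (\<Sum>j. (1 - P powr (- real (Suc j) * (\<alpha> - 1))) * P powr (- real (Suc j) * (M + 1)))
      + r powr M * (r powr \<alpha> * ((P powr (- \<alpha> + 1) - 1) / ((1 - P powr (- \<alpha>)) * P)))
      = padic_frac_coeff P \<alpha> M * r powr (M + \<alpha>)"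
    unfolding padic_frac_coeff_def powr_add[of r M \<alpha>] by (simp only: algebra_simps)
  finally show "(LINT y:{y. padic_abs y \<le> padic_abs x}|\<mu>. ?K y * padic_abs y powr M)
       = padic_frac_coeff (real CARD('p)) \<alpha> M * padic_abs x powr (M + \<alpha>)"
    by (simp add: r_def P_def)
qed

section \<open>From the Haar measure to its completion, and the remainder estimate\<close>

text \<open>The hypothesis on \<open>f\<close> concerns the completion, while the powers are
  integrated against \<open>\<mu>\<close>. Kernel times power is Borel, so both integrals
  agree.\<close>

lemma set_integral_completion:
  fixes g :: "'p padic \<Rightarrow> complex"
  assumes [measurable]: "A \<in> sets borel" "g \<in> borel_measurable borel"
  shows "set_integrable (completion \<mu>) A g \<longleftrightarrow> set_integrable \<mu> A g"
    and "(LINT y:A|completion \<mu>. g y) = (LINT y:A|\<mu>. g y)"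
proof -
  have "(\<lambda>y. indicator A y *\<^sub>R g y) \<in> borel_measurable \<mu>" by measurable
  then show "set_integrable (completion \<mu>) A g \<longleftrightarrow> set_integrable \<mu> A g"
    "(LINT y:A|completion \<mu>. g y) = (LINT y:A|\<mu>. g y)"
    unfolding set_integrable_def set_lebesgue_integral_def
    by (rule integrable_completion, rule integral_completion)
qed

text \<open>Explicit estimate at a single \<open>x\<close>: the kernel contributes
  \<open>r powr (\<alpha> - 1)\<close> and the measure of the ball \<open>r\<close>, which together
  raise the order from \<open>L\<close> to \<open>L + \<alpha>\<close>. The bound is asked only for
  \<open>y \<noteq> 0\<close>, since an expansion at 0 says nothing about
  \<open>f 0\<close>.\<close>

lemma norm_padic_frac_integral_remainder:
  fixes f :: "'p padic \<Rightarrow> complex" and M :: "nat \<Rightarrow> real" and N :: nat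
  assumes x: "padic_abs x = 1 / real CARD('p) ^ m" and \<alpha>: "1 < \<alpha>"
    and M: "\<And>n. n \<le> N \<Longrightarrow> 0 \<le> M n" and L: "0 \<le> L" and c: "0 \<le> c"
    and f: "locally_integrable (completion \<mu>) f"
    and bound: "\<And>y. y \<noteq> 0 \<Longrightarrow> padic_abs y \<le> padic_abs x \<Longrightarrow>
      norm (f y - (\<Sum>n\<le>N. a n * of_real (padic_abs y powr M n))) \<le> c * padic_abs y powr L"
  shows "norm (padic_frac_integral (completion \<mu>) \<alpha> f x
           - of_real (padic_frac_const (real CARD('p)) \<alpha>)
             * (\<Sum>n\<le>N. a n * of_real (padic_frac_coeff (real CARD('p)) \<alpha> (M n))
                         * of_real (padic_abs x powr (M n + \<alpha>))))
         \<le> \<bar>padic_frac_const (real CARD('p)) \<alpha>\<bar> * (c * padic_abs x powr (L + \<alpha>))"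
proof -
  define r where "r = padic_abs x"
  let ?\<nu> = "completion \<mu>" and ?B = "{y. padic_abs y \<le> r}"
  let ?K = "\<lambda>y. padic_abs (x - y) powr (\<alpha> - 1) - padic_abs y powr (\<alpha> - 1)"
  let ?C = "padic_frac_const (real CARD('p)) \<alpha>"
  have r: "0 < r" "r \<le> 1"
    using p_gt_1 x by (simp_all add: r_def one_le_power)
  have B: "?B \<in> sets borel" using padic_ball_sets[of 0 r] by simp
  then have B' [measurable]: "?B \<in> sets ?\<nu>" by (intro sets_completionI_sets) simp
  have K_borel: "?K \<in> borel_measurable borel"
    unfolding padic_abs_minus_commute[of x] by measurable
  then have K_meas [measurable]: "?K \<in> borel_measurable ?\<nu>"
    by (intro measurable_completion) simp
  \<comment> \<open>Both powers lie between 0 and \<open>r powr (\<alpha> - 1)\<close>, and so does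
    the modulus of their difference.\<close>
  have K_le: "\<bar>?K y\<bar> \<le> r powr (\<alpha> - 1)" if "y \<in> ?B" for y
  proof -
    have "padic_abs (x - y) \<le> r" "padic_abs y \<le> r"
      using that padic_abs_diff_ultrametric[of x y] by (auto simp: r_def)
    then have "padic_abs (x - y) powr (\<alpha> - 1) \<le> r powr (\<alpha> - 1)" "padic_abs y powr (\<alpha> - 1) \<le> r powr (\<alpha> - 1)"
      using \<alpha> by (auto intro!: powr_mono2 simp: padic_abs_nonneg)
    moreover have "0 \<le> padic_abs (x - y) powr (\<alpha> - 1)" "0 \<le> padic_abs y powr (\<alpha> - 1)" by simp_all
    ultimately show ?thesis by linarith
  qed
  define F where "F y = indicator ?B y *\<^sub>R (of_real (?K y) * f y)" for y
  define G where "G n y = indicator ?B y *\<^sub>R complex_of_real (?K y * padic_abs y powr M n)" for n y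
  \<comment> \<open>Since \<open>r \<le> 1\<close>, the ball is compact and local integrability
    applies.\<close>
  have f_int: "integrable ?\<nu> (\<lambda>y. indicator ?B y *\<^sub>R f y)"
    using f compact_padic_ball[OF r(2)] unfolding locally_integrable_def set_integrable_def by blast
  have F_int: "integrable ?\<nu> F"
  proof (rule Bochner_Integration.integrable_bound)
    show "integrable ?\<nu> (\<lambda>y. r powr (\<alpha> - 1) *\<^sub>R (indicator ?B y *\<^sub>R f y))"
      using f_int by (rule Bochner_Integration.integrable_scaleR_right)
    have [measurable]: "(\<lambda>y. indicator ?B y *\<^sub>R f y) \<in> borel_measurable ?\<nu>"
      using f_int by (rule borel_measurable_integrable)
    \<comment> \<open>Only the truncation of \<open>f\<close> to the ball is known to be measurable
      here, so the indicator is moved onto \<open>f\<close>.\<close>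
    have "F = (\<lambda>y. of_real (?K y) * (indicator ?B y *\<^sub>R f y))" by (simp add: F_def fun_eq_iff)
    also have "\<dots> \<in> borel_measurable ?\<nu>" by measurable
    finally show "F \<in> borel_measurable ?\<nu>" .
    show "AE y in ?\<nu>. norm (F y) \<le> norm (r powr (\<alpha> - 1) *\<^sub>R (indicator ?B y *\<^sub>R f y))"
    proof (rule AE_I2)
      fix y
      show "norm (F y) \<le> norm (r powr (\<alpha> - 1) *\<^sub>R (indicator ?B y *\<^sub>R f y))"
        using K_le[of y] unfolding F_def
        by (cases "y \<in> ?B") (auto simp: norm_mult simp del: of_real_diff intro!: mult_right_mono)
    qed
  qed
  have G: "integrable ?\<nu> (G n)"
    "integral\<^sup>L ?\<nu> (G n) = of_real (padic_frac_coeff (real CARD('p)) \<alpha> (M n) * r powr (M n + \<alpha>))"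
    if "n \<le> N" for n
  proof -
    have meas: "(\<lambda>y. complex_of_real (?K y * padic_abs y powr M n)) \<in> borel_measurable borel"
      using K_borel by measurable
    have "set_integrable \<mu> ?B (\<lambda>y. complex_of_real (?K y * padic_abs y powr M n))"
      using set_integrable_kernel_power[OF x \<alpha> M[OF that]]
      unfolding set_integrable_def r_def[symmetric] by (simp add: scaleR_conv_of_real flip: of_real_mult)
    then show "integrable ?\<nu> (G n)"
      using set_integral_completion(1)[OF B meas] by (simp add: set_integrable_def G_def[abs_def])
    have "integral\<^sup>L ?\<nu> (G n) = (LINT y:?B|?\<nu>. complex_of_real (?K y * padic_abs y powr M n))"
      by (simp only: set_lebesgue_integral_def G_def[abs_def])
    also have "\<dots> = of_real (LINT y:?B|\<mu>. ?K y * padic_abs y powr M n)"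
      by (subst set_integral_completion(2)[OF B meas]) (rule set_integral_complex_of_real)
    finally show "integral\<^sup>L ?\<nu> (G n) = of_real (padic_frac_coeff (real CARD('p)) \<alpha> (M n) * r powr (M n + \<alpha>))"
      using integral_kernel_power[OF x \<alpha> M[OF that]] by (simp only: r_def)
  qed
  define H where "H y = F y - (\<Sum>n\<le>N. a n * G n y)" for y
  have aG_int: "integrable ?\<nu> (\<lambda>y. a n * G n y)" if "n \<in> {..N}" for n
    using G(1) that by (intro integrable_mult_right) auto
  then have sum_int: "integrable ?\<nu> (\<lambda>y. \<Sum>n\<le>N. a n * G n y)"
    by (rule Bochner_Integration.integrable_sum)
  have H_int: "integrable ?\<nu> H"
    unfolding H_def by (intro Bochner_Integration.integrable_diff F_int sum_int)
  have "integral\<^sup>L ?\<nu> H = integral\<^sup>L ?\<nu> F - (\<Sum>n\<le>N. integral\<^sup>L ?\<nu> (\<lambda>y. a n * G n y))"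
    unfolding H_def Bochner_Integration.integral_diff[OF F_int sum_int]
    by (subst Bochner_Integration.integral_sum[OF aG_int]) simp_all
  \<comment> \<open>By linearity and the exact integrals of the \<open>G n\<close>, the whole error
    is the constant times the integral of \<open>H\<close>.\<close>
  then have H: "padic_frac_integral ?\<nu> \<alpha> f x - of_real ?C
        * (\<Sum>n\<le>N. a n * of_real (padic_frac_coeff (real CARD('p)) \<alpha> (M n)) * of_real (r powr (M n + \<alpha>)))
      = of_real ?C * integral\<^sup>L ?\<nu> H"
    using G(2) by (simp add: padic_frac_integral_def set_lebesgue_integral_def F_def[abs_def] r_def
        right_diff_distrib mult.assoc)
  let ?b = "r powr (\<alpha> - 1) * (c * r powr L)"
  \<comment> \<open>The point 0, where no bound on \<open>f\<close> is available, is null.\<close>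
  have "AE y in ?\<nu>. norm (H y) \<le> indicator ?B y * ?b"
    using AE_completion[OF AE_neq[of 0]]
  proof eventually_elim
    fix y :: "'p padic" assume y: "y \<noteq> 0"
    show "norm (H y) \<le> indicator ?B y * ?b"
    proof (cases "y \<in> ?B")
      case True
      have "H y = of_real (?K y) * (f y - (\<Sum>n\<le>N. a n * of_real (padic_abs y powr M n)))"
        using True by (simp add: H_def F_def G_def right_diff_distrib sum_distrib_left mult.left_commute)
      also have "norm \<dots> = \<bar>?K y\<bar> * norm (f y - (\<Sum>n\<le>N. a n * of_real (padic_abs y powr M n)))"
        by (simp only: norm_mult norm_of_real)
      also have "\<dots> \<le> r powr (\<alpha> - 1) * (c * padic_abs y powr L)"
        using K_le[OF True] bound[OF y] True by (intro mult_mono) (auto simp: r_def)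
      also have "\<dots> \<le> ?b"
        using True L c by (intro mult_left_mono powr_mono2) (auto simp: padic_abs_nonneg)
      finally show ?thesis using True by simp
    qed (simp add: H_def F_def G_def)
  qed
  moreover have fin: "emeasure ?\<nu> ?B = ennreal r"
    using emeasure_ball[of 0 m] B x
    by (simp add: emeasure_completion main_part_sets r_def sets_completionI_sets)
  then have "integrable ?\<nu> (\<lambda>y. indicator ?B y * ?b)"
    by (intro integrable_mult_left integrable_real_indicator B') simp
  ultimately have "(\<integral>y. norm (H y) \<partial>?\<nu>) \<le> (\<integral>y. indicator ?B y * ?b \<partial>?\<nu>)"
    by (intro integral_mono_AE integrable_norm H_int)
  also have "\<dots> = r * ?b"
    using fin r by (simp add: measure_def)
  also have "\<dots> = c * r powr (L + \<alpha>)"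
    using r powr_add[of r "\<alpha> - 1" 1] by (simp add: powr_add)
  finally have "norm (integral\<^sup>L ?\<nu> H) \<le> c * r powr (L + \<alpha>)"
    using integral_norm_bound[of ?\<nu> H] by linarith
  then have "norm (of_real ?C * integral\<^sup>L ?\<nu> H) \<le> \<bar>?C\<bar> * (c * r powr (L + \<alpha>))"
    unfolding norm_mult norm_of_real by (intro mult_left_mono) auto
  then show ?thesis unfolding H[symmetric] by (simp add: r_def)
qed

end

section \<open>Passage to the asymptotic expansion\<close>

theorem theorem1:
  fixes \<mu> :: "'p::prime_card padic measure"
    and f :: "'p padic \<Rightarrow> complex"
    and \<alpha> :: real and M :: "nat \<Rightarrow> real" and a :: "nat \<Rightarrow> complex"
  assumes haar: "haar_measure \<mu>"
    and normalized: "emeasure \<mu> {x. padic_abs x \<le> 1} = 1"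
    and alpha: "\<alpha> > 1"
    and M_pos: "0 < M 0" and M_mono: "strict_mono M" and M_lim: "filterlim M at_top sequentially"
    and f_int: "locally_integrable (completion \<mu>) f"
    and f_exp: "\<And>N. (\<lambda>x. f x - (\<Sum>n\<le>N. a n * of_real (padic_abs x powr M n)))
                  \<in> o[at 0](\<lambda>x. of_real (padic_abs x powr M N))"
  shows "\<forall>N. (\<lambda>x. padic_frac_integral (completion \<mu>) \<alpha> f x
                - of_real (padic_frac_const (real CARD('p)) \<alpha>)
                  * (\<Sum>n\<le>N. a n * of_real (padic_frac_coeff (real CARD('p)) \<alpha> (M n))
                              * of_real (padic_abs x powr (M n + \<alpha>))))
             \<in> o[at 0](\<lambda>x. of_real (padic_abs x powr (M N + \<alpha>)))"
proof (intro allI landau_o.smallI)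
  fix N :: nat and \<epsilon> :: real assume \<epsilon>: "0 < \<epsilon>"
  interpret padic_haar \<mu> by standard (rule haar, rule normalized)
  let ?C = "padic_frac_const (real CARD('p)) \<alpha>"
  \<comment> \<open>This tolerance for the remainder of \<open>f\<close> gives |?C| c \<le>
    \<epsilon>; adding 1 keeps the denominator positive.\<close>
  define c where "c = \<epsilon> / (\<bar>?C\<bar> + 1)"
  have c: "c > 0" using \<epsilon> by (simp add: c_def add_nonneg_pos)
  have "\<bar>?C\<bar> * c \<le> \<epsilon>" using \<epsilon> by (simp add: c_def pos_divide_le_eq add_nonneg_pos algebra_simps)
  have M: "M n \<ge> 0" for n
    using M_pos strict_mono_less_eq[OF M_mono, of 0 n] by simp
  have "\<forall>\<^sub>F y in at 0. norm (f y - (\<Sum>n\<le>N. a n * of_real (padic_abs y powr M n)))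
      \<le> c * norm (complex_of_real (padic_abs y powr M N))"
    using landau_o.smallD[OF f_exp c] .
  then obtain d where d: "d > 0" and bound: "\<And>y. y \<noteq> 0 \<Longrightarrow> padic_abs y < d \<Longrightarrow>
      norm (f y - (\<Sum>n\<le>N. a n * of_real (padic_abs y powr M n))) \<le> c * padic_abs y powr M N"
    unfolding eventually_at by (auto simp: dist_padic_def)
  \<comment> \<open>Staying below \<open>d\<close> makes the bound on \<open>f\<close> valid on the
    whole ball |y| \<le> |x|; staying below 1 makes |x| equal to \<open>1 / p^m\<close> for a
    natural number \<open>m\<close>.\<close>
  have "norm (padic_frac_integral (completion \<mu>) \<alpha> f x - of_real ?C
        * (\<Sum>n\<le>N. a n * of_real (padic_frac_coeff (real CARD('p)) \<alpha> (M n)) * of_real (padic_abs x powr (M n + \<alpha>))))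
      \<le> \<epsilon> * norm (complex_of_real (padic_abs x powr (M N + \<alpha>)))"
    if x: "x \<noteq> 0" "dist x 0 < min d 1" for x :: "'p padic"
  proof -
    have lt: "padic_abs x < d" "padic_abs x \<le> 1 / real CARD('p) ^ 0"
      using x by (simp_all add: dist_padic_def)
    obtain m where m: "padic_abs x = 1 / real CARD('p) ^ m"
      using padic_abs_dist_sphere_cases[of x 0 0] x lt by auto
    have "norm (padic_frac_integral (completion \<mu>) \<alpha> f x - of_real ?C
        * (\<Sum>n\<le>N. a n * of_real (padic_frac_coeff (real CARD('p)) \<alpha> (M n)) * of_real (padic_abs x powr (M n + \<alpha>))))
      \<le> \<bar>?C\<bar> * (c * padic_abs x powr (M N + \<alpha>))"
      using lt c by (intro norm_padic_frac_integral_remainder[OF m alpha] M f_int bound) auto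
    also have "\<dots> \<le> \<epsilon> * padic_abs x powr (M N + \<alpha>)"
      unfolding mult.assoc[symmetric] using \<open>\<bar>?C\<bar> * c \<le> \<epsilon>\<close> by (intro mult_right_mono) auto
    finally show ?thesis by simp
  qed
  then show "\<forall>\<^sub>F x in at 0. norm (padic_frac_integral (completion \<mu>) \<alpha> f x - of_real ?C
        * (\<Sum>n\<le>N. a n * of_real (padic_frac_coeff (real CARD('p)) \<alpha> (M n)) * of_real (padic_abs x powr (M n + \<alpha>))))
      \<le> \<epsilon> * norm (complex_of_real (padic_abs x powr (M N + \<alpha>)))"
    unfolding eventually_at using d by (intro exI[of _ "min d 1"]) auto
qed

end
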